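(* Let $N\neq 0$ be an integer and let $p,m\ge 1$ be integers with $N-mp<0$. Let $$L=\mathcal S^{N}+\sum_{i=1}^{m}u_i\,\mathcal S^{N-ip},$$ where $u_1,\dots,u_m$ are the free generators of the algebra of difference polynomials $\mathcal A=\mathbb C[\mathcal S^j(u_i)\mid 1\le i\le m,\ j\in\mathbb Z]$. Let $q=p/\gcd(N,p)$ and let $\epsilon\in\{1,-1\}$ be the sign of $N$. Then the formulas $$\partial_k(L)=[(L^{\epsilon qk})_+,L],\qquad k\ge1,$$ define an infinite hierarchy of commuting Lax flows of $L$: each $\partial_k$ is a well-defined Lax flow, $\partial_k\partial_{k'}=\partial_{k'}\partial_k$ for all $k,k'\ge1$, and the $\partial_k$ $(k\ge 1)$ span an infinite-dimensional vector space over $\mathbb C$. Moreover, the elements $h_k=\mathrm{Res}\,L^{\epsilon qk}$, $k\ge1$, are conserved densities of this hierarchy: $\partial_k(h_{k'})\in\mathrm{Im}(\mathcal S-1)$ for all $k,k'\ge1$.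
   Context: $\mathcal S$ is the shift automorphism of $\mathcal A$: $\mathcal A$ is the polynomial ring over $\mathbb C$ in the algebraically independent variables $\mathcal S^j(u_i)$, and $\mathcal S$ maps $\mathcal S^j(u_i)$ to $\mathcal S^{j+1}(u_i)$. The algebra of difference operators $\mathcal A[\mathcal S,\mathcal S^{-1}]$ (Laurent polynomials in $\mathcal S$ with coefficients in $\mathcal A$ written on the left) and the algebra of pseudodifference operators (formal Laurent series in $\mathcal S^{-1}$ with coefficients in $\mathcal A$, i.e. finitely many positive powers of $\mathcal S$ and possibly infinitely many negative ones) have the product $a\mathcal S^n\, b\mathcal S^{m}=a\,\mathcal S^n(b)\,\mathcal S^{n+m}$. The monic operator $L$ has a unique inverse among pseudodifference operators, so $L^{j}$ is defined for all $j\in\mathbb Z$. For a pseudodifference operator $P=\sum_n a_n\mathcal S^n$, $P_+=\sum_{n\ge0}a_n\mathcal S^n$ and $\mathrm{Res}\,P=a_0$. $\mathrm{Im}(\mathcal S-1)=\{\mathcal S(f)-f: f\in\mathcal A\}$. A Lax flow of $L$ is a $\mathbb C$-linear derivation $\partial$ of $\mathcal A$ commuting with $\mathcal S$ such that $\partial(L):=\sum_i\partial(u_i)\mathcal S^{N-ip}$ equals $[A,L]$ for some $A\in\mathcal A[\mathcal S,\mathcal S^{-1}]$. *)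

theory Defs
  imports Complex_Main "HOL-Library.Poly_Mapping" "HOL-Library.Function_Algebras"
begin

section \<open>Difference polynomials\<close>

text \<open>
  Polynomials over the complex numbers in the variables indexed by \<^typ>\<open>'x \<times> int\<close>:
  the pair \<open>(x, j)\<close> stands for the \<open>j\<close>-th shift of the generator \<open>x\<close>.
  The (monoid algebra) ring structure is the one of \<^theory>\<open>HOL-Library.Poly_Mapping\<close>.
\<close>

type_synonym 'x dpoly = "('x \<times> int \<Rightarrow>\<^sub>0 nat) \<Rightarrow>\<^sub>0 complex"

definition dvar :: "'x \<Rightarrow> int \<Rightarrow> 'x dpoly" where
  "dvar x j = Poly_Mapping.single (Poly_Mapping.single (x, j) 1) 1"

definition dscale :: "complex \<Rightarrow> 'x dpoly \<Rightarrow> 'x dpoly" where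
  "dscale c f = Poly_Mapping.single 0 c * f"

abbreviation ren :: "int \<Rightarrow> 'x \<times> int \<Rightarrow> 'x \<times> int" where
  "ren n \<equiv> \<lambda>(x, j). (x, j + n)"

text \<open>
  \<open>shift n\<close> is the \<open>n\<close>-th power of the shift automorphism. As \<open>map_key\<close> is composition
  with the renaming, the exponent of \<open>(x, j)\<close> in a monomial becomes the exponent of
  \<open>(x, j + n)\<close> in its shift; see \<open>shift_dvar\<close>, \<open>shift_mult\<close> and \<open>shift_shift\<close> below.
\<close>

definition shift :: "int \<Rightarrow> 'x dpoly \<Rightarrow> 'x dpoly" where
  "shift n = Poly_Mapping.map_key (Poly_Mapping.map_key (ren n))"

lemma dpoly_induct [case_names single add]:
  fixes f :: "'a \<Rightarrow>\<^sub>0 'b::comm_monoid_add"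
  assumes single: "\<And>k v. P (Poly_Mapping.single k v)"
    and add: "\<And>f g. P f \<Longrightarrow> P g \<Longrightarrow> P (f + g)"
  shows "P f"
proof (induction f rule: Poly_Mapping.update_induct)
  case const
  show ?case using single[of undefined 0] by simp
next
  case (update f a b)
  have "Poly_Mapping.update a b f = f + Poly_Mapping.single a b"
    using update(1)
    by (intro poly_mapping_eqI) (auto simp: lookup_update lookup_add lookup_single in_keys_iff when_def)
  then show ?case using add[OF update(3) single] by simp
qed

lemma inj_ren: "inj (ren n)"
  by (auto simp: inj_def)

lemma ren_comp: "ren a \<circ> ren b = ren (a + b)"
  by (auto simp: fun_eq_iff)

lemma map_key_ren_comp:
  "Poly_Mapping.map_key (ren a) (Poly_Mapping.map_key (ren b) p) =
   Poly_Mapping.map_key (ren (a + b)) p"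
  by (subst map_key_compose[OF inj_ren inj_ren]) (simp only: ren_comp add.commute)

lemma map_key_ren_0: "Poly_Mapping.map_key (ren 0) (p :: 'a \<times> int \<Rightarrow>\<^sub>0 'b::zero) = p"
proof -
  have "(ren 0 :: 'a \<times> int \<Rightarrow> _) = (\<lambda>x. x)" by auto
  then show ?thesis by (simp only: map_key_id)
qed

lemma inj_map_key_ren:
  "inj (Poly_Mapping.map_key (ren n) :: ('x \<times> int \<Rightarrow>\<^sub>0 nat) \<Rightarrow> _)"
proof (rule injI)
  fix p q :: "'x \<times> int \<Rightarrow>\<^sub>0 nat"
  assume "Poly_Mapping.map_key (ren n) p = Poly_Mapping.map_key (ren n) q"
  then have "Poly_Mapping.map_key (ren (-n)) (Poly_Mapping.map_key (ren n) p) =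
             Poly_Mapping.map_key (ren (-n)) (Poly_Mapping.map_key (ren n) q)" by simp
  then show "p = q" by (simp only: map_key_ren_comp map_key_ren_0 add.left_inverse)
qed

lemma shift_single:
  "shift n (Poly_Mapping.single M c) =
   Poly_Mapping.single (Poly_Mapping.map_key (ren (-n)) M) c"
proof -
  have "Poly_Mapping.map_key (ren n) (Poly_Mapping.map_key (ren (-n)) M) = M"
    by (simp only: map_key_ren_comp map_key_ren_0 add.right_inverse)
  then have "shift n (Poly_Mapping.single M c) = Poly_Mapping.map_key (Poly_Mapping.map_key (ren n))
    (Poly_Mapping.single (Poly_Mapping.map_key (ren n) (Poly_Mapping.map_key (ren (-n)) M)) c)"
    by (simp add: shift_def)
  also have "\<dots> = Poly_Mapping.single (Poly_Mapping.map_key (ren (-n)) M) c"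
    by (rule map_key_single[OF inj_map_key_ren])
  finally show ?thesis .
qed

lemma shift_add: "shift n (f + g) = shift n f + shift n g"
  unfolding shift_def by (rule map_key_plus[OF inj_map_key_ren])

lemma shift_0 [simp]: "shift n 0 = 0"
  unfolding shift_def by (rule map_key_zero[OF inj_map_key_ren])

lemma shift_zero_left [simp]: "shift 0 f = f"
proof (induction f rule: dpoly_induct)
  case (single k v)
  show ?case by (simp only: shift_single minus_zero map_key_ren_0)
qed (simp add: shift_add)

lemma shift_shift: "shift a (shift b f) = shift (a + b) f"
proof (induction f rule: dpoly_induct)
  case (single k v)
  show ?case by (simp only: shift_single map_key_ren_comp minus_add_distrib)
qed (simp add: shift_add)

lemma shift_sum: "shift n (sum f I) = (\<Sum>i\<in>I. shift n (f i))"
  by (induction I rule: infinite_finite_induct) (simp_all add: shift_add)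

lemma shift_mult: "shift n (f * g) = shift n f * shift n g"
proof (induction f rule: dpoly_induct)
  case s: (single k v)
  show ?case
  proof (induction g rule: dpoly_induct)
    case (single k' v')
    show ?case by (simp only: shift_single mult_single map_key_plus[OF inj_ren])
  qed (simp add: shift_add algebra_simps)
qed (simp add: shift_add algebra_simps)

lemma shift_one [simp]: "shift n 1 = 1"
  unfolding single_one[symmetric] shift_single
  by (subst map_key_zero[OF inj_ren]) (rule refl)

lemma shift_dvar: "shift n (dvar x j) = dvar x (j + n)"
proof -
  have "Poly_Mapping.map_key (ren (-n)) (Poly_Mapping.single (x, j) (1::nat)) =
        Poly_Mapping.map_key (ren (-n)) (Poly_Mapping.single (ren (-n) (x, j + n)) 1)" by simp
  also have "\<dots> = Poly_Mapping.single (x, j + n) 1"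
    by (rule map_key_single[OF inj_ren])
  finally show ?thesis by (simp only: dvar_def shift_single)
qed

lemma shift_dscale: "shift n (dscale c f) = dscale c (shift n f)"
  by (simp only: dscale_def shift_mult shift_single map_key_zero[OF inj_ren])


section \<open>Pseudodifference operators\<close>

text \<open>Formal Laurent series in the inverse shift: \<open>pscoeff P n\<close> is the (left) coefficient
  of the \<open>n\<close>-th power of the shift.\<close>

typedef 'x psdiff = "{f :: int \<Rightarrow> 'x dpoly. \<exists>K. \<forall>n>K. f n = 0}"
  morphisms pscoeff Abs_psdiff
  by auto

text \<open>Coefficients are to be kept as polynomials by \<open>lift_definition\<close> and \<open>transfer\<close>.\<close>

lifting_forget poly_mapping.lifting

setup_lifting type_definition_psdiff

lemma psdiff_eqI: "(\<And>n. pscoeff P n = pscoeff Q n) \<Longrightarrow> P = Q"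
  by transfer auto

lemma pscoeff_bounded: "\<exists>K. \<forall>n>K. pscoeff P n = 0"
  using pscoeff[of P] by simp

lift_definition psmono :: "'x dpoly \<Rightarrow> int \<Rightarrow> 'x psdiff" is
  "\<lambda>a n k. if k = n then a else 0"
  by (metis less_irrefl)

lemma psmult_sum_bound:
  assumes "\<forall>i>K. f i = 0" "\<forall>i>K'. g i = (0 :: 'x dpoly)"
    and "finite I" "{n - K'..K} \<subseteq> I"
  shows "(\<Sum>i | f i \<noteq> 0 \<and> g (n - i) \<noteq> 0. f i * shift i (g (n - i))) =
         (\<Sum>i\<in>I. f i * shift i (g (n - i)))"
proof (rule sum.mono_neutral_left)
  have "i \<in> {n - K'..K}" if "f i \<noteq> 0" "g (n - i) \<noteq> 0" for i
  proof -
    have "\<not> K < i" "\<not> K' < n - i" using assms(1,2) that by blast+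
    then show ?thesis by auto
  qed
  then show "{i. f i \<noteq> 0 \<and> g (n - i) \<noteq> 0} \<subseteq> I" using assms(4) by blast
qed (use assms(3) in auto)

instantiation psdiff :: (type) ring_1
begin

lift_definition zero_psdiff :: "'a psdiff" is "\<lambda>_. 0" by simp

definition one_psdiff :: "'a psdiff" where "1 = psmono 1 0"

lift_definition plus_psdiff :: "'a psdiff \<Rightarrow> 'a psdiff \<Rightarrow> 'a psdiff" is "\<lambda>f g n. f n + g n"
proof -
  fix f g :: "int \<Rightarrow> 'a dpoly"
  assume "\<exists>K. \<forall>n>K. f n = 0" "\<exists>K. \<forall>n>K. g n = 0"
  then obtain K K' where "\<forall>n>K. f n = 0" "\<forall>n>K'. g n = 0" by blast
  then show "\<exists>K. \<forall>n>K. f n + g n = 0" by (intro exI[of _ "max K K'"]) simp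
qed

lift_definition minus_psdiff :: "'a psdiff \<Rightarrow> 'a psdiff \<Rightarrow> 'a psdiff" is "\<lambda>f g n. f n - g n"
proof -
  fix f g :: "int \<Rightarrow> 'a dpoly"
  assume "\<exists>K. \<forall>n>K. f n = 0" "\<exists>K. \<forall>n>K. g n = 0"
  then obtain K K' where "\<forall>n>K. f n = 0" "\<forall>n>K'. g n = 0" by blast
  then show "\<exists>K. \<forall>n>K. f n - g n = 0" by (intro exI[of _ "max K K'"]) simp
qed

lift_definition uminus_psdiff :: "'a psdiff \<Rightarrow> 'a psdiff" is "\<lambda>f n. - f n"
  by auto

text \<open>The index set of the sum is finite, since the coefficients vanish in high degrees.\<close>

lift_definition times_psdiff :: "'a psdiff \<Rightarrow> 'a psdiff \<Rightarrow> 'a psdiff" is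
  "\<lambda>f g n. \<Sum>i | f i \<noteq> 0 \<and> g (n - i) \<noteq> 0. f i * shift i (g (n - i))"
proof -
  fix f g :: "int \<Rightarrow> 'a dpoly"
  assume "\<exists>K. \<forall>n>K. f n = 0" "\<exists>K. \<forall>n>K. g n = 0"
  then obtain K K' where K: "\<forall>n>K. f n = 0" "\<forall>n>K'. g n = 0" by blast
  have "(\<Sum>i | f i \<noteq> 0 \<and> g (n - i) \<noteq> 0. f i * shift i (g (n - i))) = 0" if "n > K + K'" for n
    using psmult_sum_bound[OF K, of "{}" n] that by simp
  then show "\<exists>K. \<forall>n>K. (\<Sum>i | f i \<noteq> 0 \<and> g (n - i) \<noteq> 0. f i * shift i (g (n - i))) = 0"
    by blast
qed

lemma pscoeff_mult_bound:
  assumes "\<forall>i>K. pscoeff P i = 0" "\<forall>i>K'. pscoeff Q i = 0"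
    and "finite I" "{n - K'..K} \<subseteq> I"
  shows "pscoeff (P * Q) n = (\<Sum>i\<in>I. pscoeff P i * shift i (pscoeff Q (n - i)))"
  unfolding times_psdiff.rep_eq by (rule psmult_sum_bound[OF assms])

lemma pscoeff_common_bound:
  "\<exists>K. (\<forall>i>K. pscoeff P i = 0) \<and> (\<forall>i>K. pscoeff Q i = 0) \<and> (\<forall>i>K. pscoeff R i = 0)"
proof -
  obtain a b c where "\<forall>i>a. pscoeff P i = 0" "\<forall>i>b. pscoeff Q i = 0" "\<forall>i>c. pscoeff R i = 0"
    using pscoeff_bounded by metis
  then show ?thesis by (intro exI[of _ "max a (max b c)"]) simp
qed

instance
proof
  fix P Q R :: "'a psdiff"
  show "P + Q + R = P + (Q + R)" by transfer (simp add: algebra_simps)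
  show "P + Q = Q + P" by transfer (simp add: algebra_simps)
  show "0 + P = P" by transfer simp
  show "- P + P = 0" by transfer simp
  show "P - Q = P + - Q" by transfer simp
  obtain K where K: "\<forall>i>K. pscoeff P i = 0" "\<forall>i>K. pscoeff Q i = 0" "\<forall>i>K. pscoeff R i = 0"
    using pscoeff_common_bound by blast
  have KQR: "\<forall>i>K. pscoeff (Q + R) i = 0" "\<forall>i>K. pscoeff (P + Q) i = 0"
    using K by (simp_all add: plus_psdiff.rep_eq)
  show "(P + Q) * R = P * R + Q * R"
  proof (rule psdiff_eqI)
    fix n
    show "pscoeff ((P + Q) * R) n = pscoeff (P * R + Q * R) n"
      unfolding plus_psdiff.rep_eq
        pscoeff_mult_bound[OF KQR(2) K(3) finite_atLeastAtMost_int subset_refl]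
        pscoeff_mult_bound[OF K(1) K(3) finite_atLeastAtMost_int subset_refl]
        pscoeff_mult_bound[OF K(2) K(3) finite_atLeastAtMost_int subset_refl]
      by (simp add: algebra_simps sum.distrib)
  qed
  show "P * (Q + R) = P * Q + P * R"
  proof (rule psdiff_eqI)
    fix n
    show "pscoeff (P * (Q + R)) n = pscoeff (P * Q + P * R) n"
      unfolding plus_psdiff.rep_eq
        pscoeff_mult_bound[OF K(1) KQR(1) finite_atLeastAtMost_int subset_refl]
        pscoeff_mult_bound[OF K(1) K(3) finite_atLeastAtMost_int subset_refl]
        pscoeff_mult_bound[OF K(1) K(2) finite_atLeastAtMost_int subset_refl]
      by (simp add: algebra_simps sum.distrib shift_add plus_psdiff.rep_eq)
  qed
  show "(0 :: 'a psdiff) \<noteq> 1"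
  proof
    assume "(0 :: 'a psdiff) = 1"
    then have "pscoeff (0 :: 'a psdiff) 0 = pscoeff 1 0" by simp
    then show False by (simp add: zero_psdiff.rep_eq one_psdiff_def psmono.rep_eq)
  qed
  show "1 * P = P"
  proof (rule psdiff_eqI)
    fix n
    have "pscoeff (1 * P) n = (\<Sum>i\<in>insert 0 {n - K..0}. pscoeff 1 i * shift i (pscoeff P (n - i)))"
      by (rule pscoeff_mult_bound[OF _ K(1)]) (auto simp: one_psdiff_def psmono.rep_eq)
    also have "\<dots> = (\<Sum>i\<in>{0}. pscoeff 1 i * shift i (pscoeff P (n - i)))"
      by (rule sum.mono_neutral_right) (auto simp: one_psdiff_def psmono.rep_eq)
    finally show "pscoeff (1 * P) n = pscoeff P n" by (simp add: one_psdiff_def psmono.rep_eq)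
  qed
  show "P * 1 = P"
  proof (rule psdiff_eqI)
    fix n
    have "pscoeff (P * 1) n = (\<Sum>i\<in>insert n {n - 0..K}. pscoeff P i * shift i (pscoeff 1 (n - i)))"
      by (rule pscoeff_mult_bound[OF K(1)]) (auto simp: one_psdiff_def psmono.rep_eq)
    also have "\<dots> = (\<Sum>i\<in>{n}. pscoeff P i * shift i (pscoeff 1 (n - i)))"
      by (rule sum.mono_neutral_right) (auto simp: one_psdiff_def psmono.rep_eq)
    finally show "pscoeff (P * 1) n = pscoeff P n" by (simp add: one_psdiff_def psmono.rep_eq)
  qed
  show "P * Q * R = P * (Q * R)"
  proof (rule psdiff_eqI)
    fix n
    have bPQ: "\<forall>i>2*K. pscoeff (P * Q) i = 0" and bQR: "\<forall>i>2*K. pscoeff (Q * R) i = 0"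
      by (simp_all add: pscoeff_mult_bound[OF K(1,2) finite_atLeastAtMost_int subset_refl]
          pscoeff_mult_bound[OF K(2,3) finite_atLeastAtMost_int subset_refl])
    let ?t = "\<lambda>i j. pscoeff P j * shift j (pscoeff Q (i - j)) * shift i (pscoeff R (n - i))"
    have "pscoeff (P * Q * R) n =
        (\<Sum>i\<in>{n-K..2*K}. pscoeff (P * Q) i * shift i (pscoeff R (n - i)))"
      by (rule pscoeff_mult_bound[OF bPQ K(3)]) auto
    also have "\<dots> = (\<Sum>i\<in>{n-K..2*K}. \<Sum>j\<in>{n-2*K..K}. ?t i j)"
    proof (rule sum.cong[OF refl])
      fix i assume i: "i \<in> {n-K..2*K}"
      have "pscoeff (P * Q) i = (\<Sum>j\<in>{n-2*K..K}. pscoeff P j * shift j (pscoeff Q (i - j)))"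
        by (rule pscoeff_mult_bound[OF K(1,2)]) (use i in auto)
      then show "pscoeff (P * Q) i * shift i (pscoeff R (n - i)) = (\<Sum>j\<in>{n-2*K..K}. ?t i j)"
        by (simp add: sum_distrib_right)
    qed
    also have "\<dots> = (\<Sum>j\<in>{n-2*K..K}. \<Sum>i\<in>{n-K..2*K}. ?t i j)"
      by (rule sum.swap)
    also have "\<dots> = (\<Sum>j\<in>{n-2*K..K}. pscoeff P j * shift j (pscoeff (Q * R) (n - j)))"
    proof (rule sum.cong[OF refl])
      fix j assume j: "j \<in> {n-2*K..K}"
      have "pscoeff (Q * R) (n - j) = (\<Sum>l\<in>{n-K-j..2*K-j}.
          pscoeff Q l * shift l (pscoeff R (n - j - l)))"
        by (rule pscoeff_mult_bound[OF K(2,3)]) (use j in auto)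
      also have "\<dots> = (\<Sum>i\<in>{n-K..2*K}. pscoeff Q (i - j) * shift (i - j) (pscoeff R (n - i)))"
        by (rule sum.reindex_bij_witness[of _ "\<lambda>i. i - j" "\<lambda>l. l + j"]) (auto simp: algebra_simps)
      finally show "(\<Sum>i\<in>{n-K..2*K}. ?t i j) =
          pscoeff P j * shift j (pscoeff (Q * R) (n - j))"
        by (simp add: shift_sum shift_mult shift_shift sum_distrib_left mult.assoc)
    qed
    also have "\<dots> = pscoeff (P * (Q * R)) n"
      by (rule pscoeff_mult_bound[OF K(1) bQR, symmetric]) auto
    finally show "pscoeff (P * Q * R) n = pscoeff (P * (Q * R)) n" .
  qed
qed

end

lemma psmono_mult: "psmono a n * psmono b k = psmono (a * shift n b) (n + k)"
proof (rule psdiff_eqI)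
  fix r
  have "pscoeff (psmono a n * psmono b k) r = (\<Sum>i\<in>insert n {r - k..n}.
      pscoeff (psmono a n) i * shift i (pscoeff (psmono b k) (r - i)))"
    by (rule pscoeff_mult_bound) (auto simp: psmono.rep_eq)
  also have "\<dots> = (\<Sum>i\<in>{n}. pscoeff (psmono a n) i * shift i (pscoeff (psmono b k) (r - i)))"
    by (rule sum.mono_neutral_right) (auto simp: psmono.rep_eq)
  finally show "pscoeff (psmono a n * psmono b k) r = pscoeff (psmono (a * shift n b) (n + k)) r"
    by (auto simp: psmono.rep_eq)
qed

text \<open>The two-sided inverse (unique when it exists), with value \<open>0\<close> on non-units.
  It makes integer powers available through \<^const>\<open>power_int\<close>.\<close>

instantiation psdiff :: (type) inverse
begin

definition inverse_psdiff :: "'a psdiff \<Rightarrow> 'a psdiff" where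
  "inverse_psdiff P = (if \<exists>Q. P * Q = 1 \<and> Q * P = 1 then THE Q. P * Q = 1 \<and> Q * P = 1 else 0)"

definition divide_psdiff :: "'a psdiff \<Rightarrow> 'a psdiff \<Rightarrow> 'a psdiff" where
  "divide_psdiff P Q = P * inverse Q"

instance ..

end

definition difference_operators :: "'x psdiff set" where
  "difference_operators = {P. finite {n. pscoeff P n \<noteq> 0}}"

lift_definition pos_part :: "'x psdiff \<Rightarrow> 'x psdiff" is "\<lambda>f n. if n \<ge> 0 then f n else 0"
  by auto

definition Res :: "'x psdiff \<Rightarrow> 'x dpoly" where
  "Res P = pscoeff P 0"

definition commutator :: "'x psdiff \<Rightarrow> 'x psdiff \<Rightarrow> 'x psdiff" where
  "commutator P Q = P * Q - Q * P"


section \<open>Derivations and Lax flows\<close>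

interpretation dpoly: vector_space "dscale :: complex \<Rightarrow> 'x dpoly \<Rightarrow> 'x dpoly"
  by unfold_locales
     (simp_all add: dscale_def algebra_simps single_add mult_single flip: mult.assoc)

definition endo_scale :: "complex \<Rightarrow> ('x dpoly \<Rightarrow> 'x dpoly) \<Rightarrow> 'x dpoly \<Rightarrow> 'x dpoly" where
  "endo_scale c d = (\<lambda>f. dscale c (d f))"

interpretation endo: vector_space "endo_scale :: complex \<Rightarrow> ('x dpoly \<Rightarrow> 'x dpoly) \<Rightarrow> _"
  by unfold_locales
     (simp_all add: endo_scale_def fun_eq_iff dpoly.scale_right_distrib dpoly.scale_left_distrib)

definition derivation :: "('x dpoly \<Rightarrow> 'x dpoly) \<Rightarrow> bool" where
  "derivation d \<longleftrightarrow> Vector_Spaces.linear dscale dscale d \<and> (\<forall>f g. d (f * g) = d f * g + f * d g)"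

definition diff_derivation :: "('x dpoly \<Rightarrow> 'x dpoly) \<Rightarrow> bool" where
  "diff_derivation d \<longleftrightarrow> derivation d \<and> (\<forall>f. d (shift 1 f) = shift 1 (d f))"

text \<open>The generators are labelled by a type \<^typ>\<open>'x\<close>, which \<open>e\<close> enumerates as
  \<open>e 1, \<dots>, e m\<close>; the generator \<open>u\<^sub>i\<close> is \<open>dvar (e i) 0\<close>.\<close>

definition lax_operator :: "(nat \<Rightarrow> 'x) \<Rightarrow> int \<Rightarrow> int \<Rightarrow> nat \<Rightarrow> 'x psdiff" where
  "lax_operator e N p m =
     psmono 1 N + (\<Sum>i = 1..m. psmono (dvar (e i) 0) (N - int i * p))"

definition deriv_lax_operator ::
  "(nat \<Rightarrow> 'x) \<Rightarrow> int \<Rightarrow> int \<Rightarrow> nat \<Rightarrow> ('x dpoly \<Rightarrow> 'x dpoly) \<Rightarrow> 'x psdiff" where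
  "deriv_lax_operator e N p m d = (\<Sum>i = 1..m. psmono (d (dvar (e i) 0)) (N - int i * p))"

definition lax_flow ::
  "(nat \<Rightarrow> 'x) \<Rightarrow> int \<Rightarrow> int \<Rightarrow> nat \<Rightarrow> ('x dpoly \<Rightarrow> 'x dpoly) \<Rightarrow> bool" where
  "lax_flow e N p m d \<longleftrightarrow> diff_derivation d \<and>
     (\<exists>A\<in>difference_operators.
        deriv_lax_operator e N p m d = commutator A (lax_operator e N p m))"

end

(*
  Write X for L or its inverse, of positive order |N|, P_k = X^(qk) and A_k for its nonnegative
  part. All exponents of P_k are multiples of p, so [A_k, L] = [A_k - P_k, L] has exponents N - ip
  with 1 <= i <= m and defines a derivation on the generators. Since D_k acts on all powers of X as
  the commutator with A_k, the Zakharov-Shabat equations D_k(A_l) - D_l(A_k) = [A_k, A_l] follow from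
  [P_k, P_l] = 0, and they give commutativity by the Jacobi identity; the residue of a commutator
  is a total difference.

  For infinite dimension, the lowest coefficient of [A_k, L] gives
  D_k(u_m) = u_m (1 - S^(N - mp)) h_k. Setting all generators but u_m to zero and all shifts of u_m
  to a constant, L becomes a binomial, whose powers have nonzero binomial coefficients: h_k with
  k = ml contains monomials of degree wl, w = |N|/gcd(N,p). These survive the factor
  1 - S^(N - mp) because it multiplies the coefficient sum by a nonzero number when coefficients are
  weighted by the total shift of the monomial. So the degrees of D_k(u_m) are unbounded.
*)

theory Submission
  imports Defs
begin

section \<open>Additive extension of functions on monomials\<close>

text \<open>Serves on two levels: on exponent vectors, whose entries are multiplicities of
  variables, and on polynomials, whose entries are complex coefficients.\<close>

definition linext :: "('a \<Rightarrow> 'b::comm_monoid_add \<Rightarrow> 'c::comm_monoid_add) \<Rightarrow> ('a \<Rightarrow>\<^sub>0 'b) \<Rightarrow> 'c" where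
  "linext F f = (\<Sum>k\<in>Poly_Mapping.keys f. F k (Poly_Mapping.lookup f k))"

lemma linext_superset:
  assumes "\<And>k. F k 0 = 0" "finite K" "Poly_Mapping.keys f \<subseteq> K"
  shows "linext F f = (\<Sum>k\<in>K. F k (Poly_Mapping.lookup f k))"
  unfolding linext_def using assms
  by (intro sum.mono_neutral_left) (auto simp: in_keys_iff)

lemma linext_single: "(\<And>k. F k 0 = 0) \<Longrightarrow> linext F (Poly_Mapping.single k c) = F k c"
  by (subst linext_superset[of F "{k}"]) auto

lemma linext_zero [simp]: "linext F 0 = 0"
  by (simp add: linext_def)

lemma linext_add:
  assumes "\<And>k. F k 0 = 0" "\<And>k a b. F k (a + b) = F k a + F k b"
  shows "linext F (f + g) = linext F f + linext F g"
proof -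
  let ?K = "Poly_Mapping.keys f \<union> Poly_Mapping.keys g"
  have "linext F h = (\<Sum>k\<in>?K. F k (Poly_Mapping.lookup h k))"
    if "Poly_Mapping.keys h \<subseteq> ?K" for h
    by (rule linext_superset) (use assms(1) that in auto)
  then show ?thesis
    by (simp add: Poly_Mapping.keys_add lookup_add assms(2) sum.distrib)
qed

lemma dscale_single: "dscale c (Poly_Mapping.single M b) = Poly_Mapping.single M (c * b)"
  by (simp add: dscale_def mult_single)

lemma dscale_mult_left: "dscale c f * g = dscale c (f * g)"
  by (simp add: dscale_def mult.assoc)

lemma dscale_mult_right: "f * dscale c g = dscale c (f * g)"
  by (simp add: dscale_def mult_ac)

lemma keys_dscale: "Poly_Mapping.keys (dscale c f) \<subseteq> Poly_Mapping.keys f"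
proof -
  have "Poly_Mapping.lookup (dscale c f) M = c * Poly_Mapping.lookup f M" for M
    by (induction f rule: dpoly_induct)
       (auto simp: dscale_single dpoly.scale_right_distrib lookup_add lookup_single when_def
         distrib_left)
  then show ?thesis by (auto simp: in_keys_iff)
qed

section \<open>Derivations with prescribed values on the variables\<close>

text \<open>The Leibniz rule on one monomial. Subtraction of exponents is truncated, but it is exact
  here because \<open>v\<close> occurs in \<open>M\<close>.\<close>

definition mono_deriv :: "('x \<times> int \<Rightarrow> 'x dpoly) \<Rightarrow> ('x \<times> int \<Rightarrow>\<^sub>0 nat) \<Rightarrow> 'x dpoly" where
  "mono_deriv a M = (\<Sum>v\<in>Poly_Mapping.keys M.
     Poly_Mapping.single (M - Poly_Mapping.single v 1) (of_nat (Poly_Mapping.lookup M v)) * a v)"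

definition deriv_ext :: "('x \<times> int \<Rightarrow> 'x dpoly) \<Rightarrow> 'x dpoly \<Rightarrow> 'x dpoly" where
  "deriv_ext a = linext (\<lambda>M c. dscale c (mono_deriv a M))"

lemma mono_deriv_superset:
  assumes "finite K" "Poly_Mapping.keys M \<subseteq> K"
  shows "mono_deriv a M = (\<Sum>v\<in>K.
     Poly_Mapping.single (M - Poly_Mapping.single v 1) (of_nat (Poly_Mapping.lookup M v)) * a v)"
  unfolding mono_deriv_def using assms
  by (intro sum.mono_neutral_left) (auto simp: in_keys_iff)

lemma mono_deriv_add:
  "mono_deriv a (M + M') =
     Poly_Mapping.single M 1 * mono_deriv a M' + mono_deriv a M * Poly_Mapping.single M' 1"
proof -
  let ?K = "Poly_Mapping.keys M \<union> Poly_Mapping.keys M'"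
  let ?l = Poly_Mapping.lookup
  \<comment> \<open>The multiplicity \<open>?l B v\<close> belongs to the identity: if
    \<open>v\<close> does not occur in \<open>B\<close>, truncated subtraction may give different
    exponents, but then both sides are zero.\<close>
  have *: "Poly_Mapping.single (A + B - Poly_Mapping.single v 1) (of_nat (?l B v)) =
      Poly_Mapping.single A 1 *
      Poly_Mapping.single (B - Poly_Mapping.single v 1) (of_nat (?l B v) :: complex)"
    for A B :: "'a \<times> int \<Rightarrow>\<^sub>0 nat" and v
  proof (cases "?l B v = 0")
    case False
    then have "A + B - Poly_Mapping.single v 1 = A + (B - Poly_Mapping.single v 1)"
      by (intro poly_mapping_eqI) (auto simp: lookup_add lookup_minus lookup_single when_def)
    then show ?thesis by (simp add: mult_single)
  qed simp
  have "mono_deriv a (M + M') = (\<Sum>v\<in>?K.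
      Poly_Mapping.single (M + M' - Poly_Mapping.single v 1) (of_nat (?l (M + M') v)) * a v)"
    by (rule mono_deriv_superset) (auto simp: Poly_Mapping.keys_add)
  also have "\<dots> = (\<Sum>v\<in>?K.
      Poly_Mapping.single (M' + M - Poly_Mapping.single v 1) (of_nat (?l M v)) * a v +
      Poly_Mapping.single (M + M' - Poly_Mapping.single v 1) (of_nat (?l M' v)) * a v)"
    by (intro sum.cong refl) (simp add: lookup_add single_add algebra_simps)
  also have "\<dots> = Poly_Mapping.single M' 1 * mono_deriv a M + Poly_Mapping.single M 1 * mono_deriv a M'"
    unfolding * by (simp add: mono_deriv_superset[of ?K] sum.distrib sum_distrib_left mult.assoc)
  finally show ?thesis by (simp add: algebra_simps)
qed

lemma deriv_ext_single: "deriv_ext a (Poly_Mapping.single M c) = dscale c (mono_deriv a M)"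
  unfolding deriv_ext_def by (rule linext_single) simp

lemma deriv_ext_add: "deriv_ext a (f + g) = deriv_ext a f + deriv_ext a g"
  unfolding deriv_ext_def by (rule linext_add) (simp_all add: dpoly.scale_left_distrib)

lemma deriv_ext_dscale: "deriv_ext a (dscale c f) = dscale c (deriv_ext a f)"
  by (induction f rule: dpoly_induct)
     (simp_all add: deriv_ext_add dpoly.scale_right_distrib dscale_single deriv_ext_single)

lemma deriv_ext_mult: "deriv_ext a (f * g) = deriv_ext a f * g + f * deriv_ext a g"
proof (induction f rule: dpoly_induct)
  case s: (single M c)
  show ?case
  proof (induction g rule: dpoly_induct)
    case (single M' c')
    have "deriv_ext a (Poly_Mapping.single M c * Poly_Mapping.single M' c') =
        dscale (c * c') (Poly_Mapping.single M 1 * mono_deriv a M' +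
          mono_deriv a M * Poly_Mapping.single M' 1)"
      by (simp only: mult_single deriv_ext_single mono_deriv_add)
    also have "\<dots> = dscale c (mono_deriv a M) * dscale c' (Poly_Mapping.single M' 1) +
        dscale c (Poly_Mapping.single M 1) * dscale c' (mono_deriv a M')"
      by (simp only: dscale_mult_left dscale_mult_right dpoly.scale_scale
          dpoly.scale_right_distrib add.commute mult.commute)
    also have "\<dots> = deriv_ext a (Poly_Mapping.single M c) * Poly_Mapping.single M' c' +
        Poly_Mapping.single M c * deriv_ext a (Poly_Mapping.single M' c')"
      by (simp only: dscale_single mult_1_right deriv_ext_single)
    finally show ?case .
  qed (simp add: deriv_ext_add algebra_simps)
qed (simp add: deriv_ext_add algebra_simps)

lemma linear_dscaleI:
  assumes "\<And>f g. d (f + g) = d f + d g" "\<And>c f. d (dscale c f) = dscale c (d f)"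
  shows "Vector_Spaces.linear dscale dscale d"
  by unfold_locales (use assms in auto)

lemma derivation_deriv_ext: "derivation (deriv_ext a)"
  unfolding derivation_def
  using linear_dscaleI[of "deriv_ext a"] deriv_ext_add deriv_ext_dscale deriv_ext_mult by blast

lemma deriv_ext_dvar: "deriv_ext a (dvar x j) = a (x, j)"
  by (simp add: dvar_def deriv_ext_single mono_deriv_def del: One_nat_def)

context
  fixes d :: "'x dpoly \<Rightarrow> 'x dpoly"
  assumes der: "derivation d"
begin

lemma derivation_add: "d (f + g) = d f + d g"
  using der unfolding derivation_def by (metis Vector_Spaces.linear_iff)

lemma derivation_dscale: "d (dscale c f) = dscale c (d f)"
  using der unfolding derivation_def by (metis Vector_Spaces.linear_iff)

lemma derivation_mult: "d (f * g) = d f * g + f * d g"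
  using der unfolding derivation_def by simp

lemma derivation_zero: "d 0 = 0"
  using derivation_add[of 0 0] by simp

lemma derivation_one: "d 1 = 0"
  using derivation_mult[of 1 1] by simp

lemma derivation_minus: "d (f - g) = d f - d g"
  using derivation_add[of "f - g" g] by (simp add: algebra_simps)

lemma derivation_sum: "d (\<Sum>i\<in>I. f i) = (\<Sum>i\<in>I. d (f i))"
  by (induction I rule: infinite_finite_induct) (simp_all add: derivation_zero derivation_add)

end

text \<open>The Leibniz rule carries agreement from the variables to their powers and to all
  monomials; linearity does the rest.\<close>

lemma derivation_eqI:
  assumes "derivation d" "derivation d'" "\<And>x j. d (dvar x j) = d' (dvar x j)"
  shows "d = d'"
proof
  fix f
  have one: "d (Poly_Mapping.single M 1) = d' (Poly_Mapping.single M 1)" for M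
  proof (induction M rule: dpoly_induct)
    case (single v n)
    show ?case
    proof (induction n)
      case 0
      show ?case by (simp add: derivation_one[OF assms(1)] derivation_one[OF assms(2)])
    next
      case (Suc n)
      have "Poly_Mapping.single (Poly_Mapping.single v (Suc n)) (1::complex) =
          dvar (fst v) (snd v) * Poly_Mapping.single (Poly_Mapping.single v n) 1"
        by (simp add: dvar_def mult_single single_add[symmetric])
      then show ?case
        by (simp add: derivation_mult[OF assms(1)] derivation_mult[OF assms(2)] Suc assms(3))
    qed
  next
    case (add M M')
    have "Poly_Mapping.single (M + M') (1::complex) =
        Poly_Mapping.single M 1 * Poly_Mapping.single M' 1"
      by (simp add: mult_single)
    then show ?case
      by (simp add: derivation_mult[OF assms(1)] derivation_mult[OF assms(2)] add)
  qed
  show "d f = d' f"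
  proof (induction f rule: dpoly_induct)
    case (single M c)
    have "Poly_Mapping.single M c = dscale c (Poly_Mapping.single M 1)"
      by (simp add: dscale_single)
    then show ?case
      by (simp only: derivation_dscale[OF assms(1)] derivation_dscale[OF assms(2)] one)
  qed (simp add: derivation_add[OF assms(1)] derivation_add[OF assms(2)])
qed

lemma diff_derivation_derivation: "diff_derivation d \<Longrightarrow> derivation d"
  by (simp add: diff_derivation_def)

lemma shift_diff: "shift n (f - g) = shift n f - shift n g"
  using shift_add[of n "f - g" g] by (simp add: algebra_simps)

lemma diff_derivation_shift:
  assumes "diff_derivation d"
  shows "d (shift n f) = shift n (d f)"
proof -
  have 1: "d (shift 1 f) = shift 1 (d f)" for f
    using assms by (simp add: diff_derivation_def)
  show ?thesis
  proof (induction n arbitrary: f rule: int_induct[of _ 0])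
    case base
    show ?case by simp
  next
    case (step1 i)
    have "d (shift (i + 1) f) = d (shift 1 (shift i f))"
      by (simp only: shift_shift add.commute)
    also have "\<dots> = shift 1 (d (shift i f))" by (rule 1)
    also have "\<dots> = shift (i + 1) (d f)"
      by (simp only: step1 shift_shift add.commute)
    finally show ?case .
  next
    case (step2 i)
    \<comment> \<open>Downwards, commutation with \<open>shift 1\<close> is applied to
      \<open>shift (i - 1) f\<close>, and then \<open>shift 1\<close> is cancelled.\<close>
    have "shift 1 (d (shift (i - 1) f)) = d (shift i f)" by (simp add: 1[symmetric] shift_shift)
    also have "\<dots> = shift i (d f)" by (rule step2)
    finally have "shift (-1) (shift 1 (d (shift (i - 1) f))) = shift (-1) (shift i (d f))" by simp
    then show ?case by (simp add: shift_shift)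
  qed
qed

lemma diff_derivation_eqI:
  fixes d :: "'x dpoly \<Rightarrow> 'x dpoly"
  assumes "diff_derivation d" "diff_derivation d'" "\<And>x. d (dvar x 0) = d' (dvar x 0)"
  shows "d = d'"
proof (rule derivation_eqI)
  fix x :: 'x and j
  have "dvar x j = shift j (dvar x 0)" by (simp add: shift_dvar)
  then show "d (dvar x j) = d' (dvar x j)"
    by (simp only: diff_derivation_shift assms)
qed (use assms in \<open>simp_all add: diff_derivation_def\<close>)

text \<open>Conjugation by the shift yields a derivation with the same values on the variables,
  hence the same derivation.\<close>

lemma diff_derivation_deriv_ext: "diff_derivation (deriv_ext (\<lambda>(x, j). shift j (a x)))"
  (is "diff_derivation ?d")
proof -
  note der = derivation_deriv_ext[of "\<lambda>(x, j). shift j (a x)"]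
  have "(\<lambda>f. shift (-1) (?d (shift 1 f))) = ?d"
  proof (rule derivation_eqI[OF _ der])
    show "derivation (\<lambda>f. shift (-1) (?d (shift 1 f)))"
      unfolding derivation_def
      by (intro conjI linear_dscaleI)
         (simp_all add: shift_add shift_dscale shift_mult shift_shift
           derivation_add[OF der] derivation_dscale[OF der] derivation_mult[OF der])
  qed (simp add: shift_dvar deriv_ext_dvar shift_shift)
  then have "shift 1 (shift (-1) (?d (shift 1 f))) = shift 1 (?d f)" for f
    by (simp only: fun_eq_iff)
  then have "?d (shift 1 f) = shift 1 (?d f)" for f
    by (simp add: shift_shift)
  then show ?thesis using der by (simp add: diff_derivation_def)
qed

text \<open>Allows the commutation of two flows to be tested on the unshifted generators
  alone.\<close>

lemma diff_derivation_commutator: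
  assumes d: "diff_derivation d" and d': "diff_derivation d'"
  shows "diff_derivation (\<lambda>f. d (d' f) - d' (d f))"
proof -
  note D = diff_derivation_derivation[OF d] and D' = diff_derivation_derivation[OF d']
  show ?thesis
    unfolding diff_derivation_def derivation_def
    by (intro conjI allI linear_dscaleI)
       (simp_all add: derivation_add[OF D] derivation_add[OF D'] derivation_dscale[OF D]
         derivation_dscale[OF D'] derivation_mult[OF D] derivation_mult[OF D']
         diff_derivation_shift[OF d] diff_derivation_shift[OF d'] shift_diff
         dpoly.scale_right_diff_distrib algebra_simps)
qed

lemma diff_derivation_zero: "diff_derivation (\<lambda>_. 0)"
  unfolding diff_derivation_def derivation_def by (intro conjI allI linear_dscaleI) simp_all

section \<open>Functionals on difference polynomials\<close>

definition mdeg :: "('a \<Rightarrow>\<^sub>0 nat) \<Rightarrow> nat" where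
  "mdeg = linext (\<lambda>_ n. n)"

text \<open>The total shift of a monomial, counted with multiplicity.\<close>

definition moment :: "('x \<times> int \<Rightarrow>\<^sub>0 nat) \<Rightarrow> int" where
  "moment = linext (\<lambda>v n. int n * snd v)"

definition degree_off :: "'x \<Rightarrow> ('x \<times> int \<Rightarrow>\<^sub>0 nat) \<Rightarrow> nat" where
  "degree_off x = linext (\<lambda>v n. if fst v = x then 0 else n)"

lemma mdeg_add: "mdeg (M + M') = mdeg M + mdeg M'"
  unfolding mdeg_def by (rule linext_add) auto

lemma moment_add: "moment (M + M') = moment M + moment M'"
  unfolding moment_def by (rule linext_add) (auto simp: algebra_simps)

lemma degree_off_add: "degree_off x (M + M') = degree_off x M + degree_off x M'"
  unfolding degree_off_def by (rule linext_add) auto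

lemma mdeg_single: "mdeg (Poly_Mapping.single v n) = n"
  unfolding mdeg_def by (rule linext_single) auto

lemma moment_single: "moment (Poly_Mapping.single v n) = int n * snd v"
  unfolding moment_def by (rule linext_single) auto

lemma degree_off_single: "degree_off x (Poly_Mapping.single v n) = (if fst v = x then 0 else n)"
  unfolding degree_off_def by (rule linext_single) auto

lemma mdeg_zero [simp]: "mdeg 0 = 0"
  by (simp add: mdeg_def)

lemma degree_off_zero [simp]: "degree_off x 0 = 0"
  by (simp add: degree_off_def)

lemma map_key_ren_single:
  "Poly_Mapping.map_key (ren (- n)) (Poly_Mapping.single (x, j) c) = Poly_Mapping.single (x, j + n) c"
proof -
  have "Poly_Mapping.map_key (ren (- n)) (Poly_Mapping.single (ren (- n) (x, j + n)) c) =
      Poly_Mapping.single (x, j + n) c"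
    by (rule map_key_single[OF inj_ren])
  then show ?thesis by simp
qed

lemma mdeg_map_key_ren: "mdeg (Poly_Mapping.map_key (ren (- n)) M) = mdeg M"
proof (induction M rule: dpoly_induct)
  case (single v c)
  show ?case by (cases v) (simp only: map_key_ren_single mdeg_single)
qed (simp only: map_key_plus[OF inj_ren] mdeg_add)

lemma degree_off_map_key_ren: "degree_off x (Poly_Mapping.map_key (ren (- n)) M) = degree_off x M"
proof (induction M rule: dpoly_induct)
  case (single v c)
  show ?case by (cases v) (simp only: map_key_ren_single degree_off_single fst_conv)
qed (simp only: map_key_plus[OF inj_ren] degree_off_add)

text \<open>\<open>map_key (ren (- n))\<close> is the action of \<open>shift n\<close> on monomials:
  each of the \<open>mdeg M\<close> factors moves by \<open>n\<close>.\<close>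

lemma moment_map_key_ren:
  "moment (Poly_Mapping.map_key (ren (- n)) M) = moment M + n * int (mdeg M)"
proof (induction M rule: dpoly_induct)
  case (single v c)
  obtain x j where "v = (x, j)" by (cases v)
  then show ?case
    by (simp only: map_key_ren_single moment_single mdeg_single) (simp add: algebra_simps)
qed (simp only: map_key_plus[OF inj_ren] moment_add mdeg_add, simp add: algebra_simps)

text \<open>The degree-\<open>j\<close> coefficient of the specialisation that sends all shifts of \<open>x\<close> to one
  indeterminate and the other generators to \<open>0\<close>.\<close>

definition coeff_sum :: "'x \<Rightarrow> nat \<Rightarrow> 'x dpoly \<Rightarrow> complex" where
  "coeff_sum x j = linext (\<lambda>M c. if mdeg M = j \<and> degree_off x M = 0 then c else 0)"

text \<open>Weighting by the total shift detects differences \<open>f - shift n f\<close>, on which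
  the shift-invariant \<open>coeff_sum\<close> vanishes.\<close>

definition moment_sum :: "'x \<Rightarrow> nat \<Rightarrow> 'x dpoly \<Rightarrow> complex" where
  "moment_sum x j =
     linext (\<lambda>M c. if mdeg M = j \<and> degree_off x M = 0 then of_int (moment M) * c else 0)"

lemma coeff_sum_single: "coeff_sum x j (Poly_Mapping.single M c) =
    (if mdeg M = j \<and> degree_off x M = 0 then c else 0)"
  unfolding coeff_sum_def by (rule linext_single) auto

lemma moment_sum_single: "moment_sum x j (Poly_Mapping.single M c) =
    (if mdeg M = j \<and> degree_off x M = 0 then of_int (moment M) * c else 0)"
  unfolding moment_sum_def by (rule linext_single) auto

lemma coeff_sum_add: "coeff_sum x j (f + g) = coeff_sum x j f + coeff_sum x j g"
  unfolding coeff_sum_def by (rule linext_add) auto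

lemma moment_sum_add: "moment_sum x j (f + g) = moment_sum x j f + moment_sum x j g"
  unfolding moment_sum_def by (rule linext_add) (auto simp: algebra_simps)

lemma coeff_sum_zero [simp]: "coeff_sum x j 0 = 0"
  by (simp add: coeff_sum_def)

lemma coeff_sum_sum: "coeff_sum x j (\<Sum>i\<in>I. f i) = (\<Sum>i\<in>I. coeff_sum x j (f i))"
  by (induction I rule: infinite_finite_induct)
     (simp_all add: coeff_sum_add)

lemma moment_sum_diff: "moment_sum x j (f - g) = moment_sum x j f - moment_sum x j g"
  using moment_sum_add[of x j "f - g" g] by simp

lemma coeff_sum_one: "coeff_sum x j 1 = (if j = 0 then 1 else 0)"
  by (simp add: single_one[symmetric] coeff_sum_single del: single_one)

lemma coeff_sum_shift: "coeff_sum x j (shift n f) = coeff_sum x j f"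
  by (induction f rule: dpoly_induct)
     (simp_all only: shift_single coeff_sum_single mdeg_map_key_ren degree_off_map_key_ren
       shift_add coeff_sum_add)

lemma moment_sum_shift:
  "moment_sum x j (shift n f) = moment_sum x j f + of_int (n * int j) * coeff_sum x j f"
proof (induction f rule: dpoly_induct)
  case (single M c)
  show ?case
    by (simp only: shift_single coeff_sum_single moment_sum_single mdeg_map_key_ren
        degree_off_map_key_ren moment_map_key_ren) (simp add: algebra_simps)
qed (simp add: shift_add coeff_sum_add moment_sum_add algebra_simps)

lemma coeff_sum_dvar_mult:
  "coeff_sum x (Suc j) (dvar y i * f) = (if y = x then coeff_sum x j f else 0)"
  by (induction f rule: dpoly_induct)
     (auto simp: dvar_def mult_single coeff_sum_single coeff_sum_add mdeg_add mdeg_single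
       degree_off_add degree_off_single distrib_left)

lemma coeff_sum_0_dvar_mult: "coeff_sum x 0 (dvar y i * f) = 0"
  by (induction f rule: dpoly_induct)
     (auto simp: dvar_def mult_single coeff_sum_single coeff_sum_add mdeg_add mdeg_single
       distrib_left)

text \<open>The unshifted variable raises the degree by one and adds nothing to the total
  shift.\<close>

lemma moment_sum_dvar_mult: "moment_sum x (Suc j) (dvar x 0 * f) = moment_sum x j f"
  by (induction f rule: dpoly_induct)
     (auto simp: dvar_def mult_single moment_sum_single moment_sum_add mdeg_add mdeg_single
       degree_off_add degree_off_single moment_add moment_single distrib_left)

lemma moment_sum_nonzero:
  assumes "moment_sum x j f \<noteq> 0"
  shows "j \<in> mdeg ` Poly_Mapping.keys f"
proof (rule ccontr)
  assume "j \<notin> mdeg ` Poly_Mapping.keys f"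
  then have "moment_sum x j f = 0"
    unfolding moment_sum_def linext_def by (intro sum.neutral) auto
  then show False using assms by simp
qed

section \<open>Orders and supports of pseudodifference operators\<close>

lemma pscoeff_zero [simp]: "pscoeff 0 n = 0"
  by (simp add: zero_psdiff.rep_eq)

lemma pscoeff_one: "pscoeff 1 n = (if n = 0 then 1 else 0)"
  by (simp add: one_psdiff_def psmono.rep_eq)

lemma pscoeff_sum: "pscoeff (\<Sum>i\<in>I. F i) n = (\<Sum>i\<in>I. pscoeff (F i) n)"
  by (induction I rule: infinite_finite_induct) (simp_all add: plus_psdiff.rep_eq)

lemmas pscoeff_simps = plus_psdiff.rep_eq minus_psdiff.rep_eq uminus_psdiff.rep_eq
  psmono.rep_eq pscoeff_one pscoeff_sum pos_part.rep_eq

lemma pscoeff_mult_nonzero: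
  assumes "pscoeff (P * Q) n \<noteq> 0"
  obtains i where "pscoeff P i \<noteq> 0" "pscoeff Q (n - i) \<noteq> 0"
  using assms unfolding times_psdiff.rep_eq
  by (metis (mono_tags, lifting) mem_Collect_eq sum.not_neutral_contains_not_neutral)

lemma pscoeff_psmono_mult: "pscoeff (psmono a n * P) r = a * shift n (pscoeff P (r - n))"
proof -
  obtain K where K: "\<forall>i>K. pscoeff P i = 0" using pscoeff_bounded by blast
  have "pscoeff (psmono a n * P) r = (\<Sum>i\<in>insert n {r - K..n}.
      pscoeff (psmono a n) i * shift i (pscoeff P (r - i)))"
    by (rule pscoeff_mult_bound[OF _ K]) (auto simp: psmono.rep_eq)
  also have "\<dots> = (\<Sum>i\<in>{n}. pscoeff (psmono a n) i * shift i (pscoeff P (r - i)))"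
    by (rule sum.mono_neutral_right) (auto simp: psmono.rep_eq)
  finally show ?thesis by (simp add: psmono.rep_eq)
qed

lemma psmono_one_inverse: "psmono 1 n * psmono 1 (- n) = 1" "psmono 1 (- n) * psmono 1 n = 1"
  by (simp_all add: psmono_mult one_psdiff_def)

definition order_le :: "'x psdiff \<Rightarrow> int \<Rightarrow> bool" where
  "order_le P K \<longleftrightarrow> (\<forall>i>K. pscoeff P i = 0)"

definition order_ge :: "'x psdiff \<Rightarrow> int \<Rightarrow> bool" where
  "order_ge P K \<longleftrightarrow> (\<forall>i<K. pscoeff P i = 0)"

text \<open>All exponents lie in one residue class. With bounds on the order, this grading confines
  the commutators to the exponents \<open>N - int i * p\<close>.\<close>

definition supported_mod :: "int \<Rightarrow> int \<Rightarrow> 'x psdiff \<Rightarrow> bool" where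
  "supported_mod p a P \<longleftrightarrow> (\<forall>i. pscoeff P i \<noteq> 0 \<longrightarrow> p dvd i - a)"

lemma order_le_add: "order_le P K \<Longrightarrow> order_le Q K \<Longrightarrow> order_le (P + Q) K"
  and order_le_diff: "order_le P K \<Longrightarrow> order_le Q K \<Longrightarrow> order_le (P - Q) K"
  and order_le_uminus: "order_le P K \<Longrightarrow> order_le (- P) K"
  and order_le_mono: "order_le P K \<Longrightarrow> K \<le> K' \<Longrightarrow> order_le P K'"
  and order_le_psmono: "order_le (psmono a n) n"
  and order_le_one: "order_le 1 0"
  by (auto simp: order_le_def pscoeff_simps)

lemma order_le_sum: "(\<And>i. i \<in> I \<Longrightarrow> order_le (F i) K) \<Longrightarrow> order_le (\<Sum>i\<in>I. F i) K"
  by (auto simp: order_le_def pscoeff_simps intro: sum.neutral)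

lemma order_le_mult:
  assumes "order_le P K" "order_le Q K'"
  shows "order_le (P * Q) (K + K')"
  unfolding order_le_def
proof (intro allI impI, rule ccontr)
  fix n assume n: "n > K + K'" and "pscoeff (P * Q) n \<noteq> 0"
  then obtain i where "pscoeff P i \<noteq> 0" "pscoeff Q (n - i) \<noteq> 0"
    by (rule_tac pscoeff_mult_nonzero)
  then have "\<not> i > K" "\<not> n - i > K'" using assms by (auto simp: order_le_def)
  then show False using n by linarith
qed

lemma order_le_power: "order_le P K \<Longrightarrow> order_le (P ^ n) (int n * K)"
proof (induction n)
  case (Suc n)
  then show ?case using order_le_mult[of P K "P ^ n" "int n * K"] by (simp add: algebra_simps)
qed (simp add: order_le_one)

lemma order_ge_diff: "order_ge P K \<Longrightarrow> order_ge Q K \<Longrightarrow> order_ge (P - Q) K"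
  and order_ge_pos_part: "order_ge (pos_part P) 0"
  by (auto simp: order_ge_def pscoeff_simps)

lemma order_ge_mult:
  assumes "order_ge P K" "order_ge Q K'"
  shows "order_ge (P * Q) (K + K')"
  unfolding order_ge_def
proof (intro allI impI, rule ccontr)
  fix n assume n: "n < K + K'" and "pscoeff (P * Q) n \<noteq> 0"
  then obtain i where "pscoeff P i \<noteq> 0" "pscoeff Q (n - i) \<noteq> 0"
    by (rule_tac pscoeff_mult_nonzero)
  then have "\<not> i < K" "\<not> n - i < K'" using assms by (auto simp: order_ge_def)
  then show False using n by linarith
qed

text \<open>Only the pair of lowest terms can contribute to the exponent
  \<open>K + K'\<close>.\<close>

lemma pscoeff_mult_lowest:
  assumes "order_ge P K" "order_ge Q K'"
  shows "pscoeff (P * Q) (K + K') = pscoeff P K * shift K (pscoeff Q K')"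
proof -
  have "{i. pscoeff P i \<noteq> 0 \<and> pscoeff Q (K + K' - i) \<noteq> 0} \<subseteq> {K}"
  proof
    fix i assume "i \<in> {i. pscoeff P i \<noteq> 0 \<and> pscoeff Q (K + K' - i) \<noteq> 0}"
    then have "\<not> i < K" "\<not> K + K' - i < K'" using assms by (auto simp: order_ge_def)
    then show "i \<in> {K}" by simp
  qed
  then have "pscoeff (P * Q) (K + K') =
      (\<Sum>i\<in>{K}. pscoeff P i * shift i (pscoeff Q (K + K' - i)))"
    unfolding times_psdiff.rep_eq by (intro sum.mono_neutral_left) auto
  then show ?thesis by simp
qed

lemma supported_mod_add:
  "supported_mod p a P \<Longrightarrow> supported_mod p a Q \<Longrightarrow> supported_mod p a (P + Q)"
  unfolding supported_mod_def plus_psdiff.rep_eq by (metis add_0)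

lemma supported_mod_diff:
  "supported_mod p a P \<Longrightarrow> supported_mod p a Q \<Longrightarrow> supported_mod p a (P - Q)"
  unfolding supported_mod_def minus_psdiff.rep_eq by (metis diff_zero)

lemma supported_mod_uminus: "supported_mod p a P \<Longrightarrow> supported_mod p a (- P)"
  and supported_mod_pos_part: "supported_mod p a P \<Longrightarrow> supported_mod p a (pos_part P)"
  and supported_mod_one: "supported_mod p 0 1"
  and supported_mod_psmono: "p dvd n - a \<Longrightarrow> supported_mod p a (psmono c n)"
  by (simp_all add: supported_mod_def pscoeff_simps)

lemma supported_mod_sum:
  "(\<And>i. i \<in> I \<Longrightarrow> supported_mod p a (F i)) \<Longrightarrow> supported_mod p a (\<Sum>i\<in>I. F i)"
  by (auto simp: supported_mod_def pscoeff_simps elim!: sum.not_neutral_contains_not_neutral)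

lemma supported_mod_mult:
  assumes "supported_mod p a P" "supported_mod p b Q"
  shows "supported_mod p (a + b) (P * Q)"
  unfolding supported_mod_def
proof (intro allI impI)
  fix n assume "pscoeff (P * Q) n \<noteq> 0"
  then obtain i where "pscoeff P i \<noteq> 0" "pscoeff Q (n - i) \<noteq> 0"
    by (rule pscoeff_mult_nonzero)
  then have "p dvd (i - a) + (n - i - b)"
    using assms by (intro dvd_add) (auto simp: supported_mod_def)
  then show "p dvd n - (a + b)" by (simp add: algebra_simps)
qed

lemma supported_mod_power: "supported_mod p a P \<Longrightarrow> supported_mod p (int n * a) (P ^ n)"
proof (induction n)
  case (Suc n)
  then show ?case
    using supported_mod_mult[of p a P "int n * a" "P ^ n"] by (simp add: algebra_simps)
qed (simp add: supported_mod_one)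

lemma supported_mod_cong:
  assumes "supported_mod p a P" "p dvd a - b"
  shows "supported_mod p b P"
  unfolding supported_mod_def
proof (intro allI impI)
  fix i assume "pscoeff P i \<noteq> 0"
  then have "p dvd (i - a) + (a - b)"
    using assms by (intro dvd_add) (auto simp: supported_mod_def)
  then show "p dvd i - b" by simp
qed

text \<open>The filtration by order is separated, so identities of infinite series can be checked up
  to terms of arbitrarily low order.\<close>

lemma eq_zero_if_order_le:
  assumes "\<And>K::nat. order_le P (- int K)"
  shows "P = 0"
proof (rule psdiff_eqI)
  fix n
  have "n > - int (nat (1 - n))" by linarith
  then show "pscoeff P n = pscoeff 0 n" using assms[of "nat (1 - n)"] by (simp add: order_le_def)
qed

section \<open>Inverses\<close>

text \<open>The truncation at \<open>i = - n\<close> loses nothing when \<open>U\<close> has negative order.\<close>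

lift_definition geometric :: "'x psdiff \<Rightarrow> 'x psdiff" is
  "\<lambda>U n. if n > 0 then 0 else (\<Sum>i\<le>nat (- n). pscoeff (Abs_psdiff U ^ i) n)"
  by auto

lemma pscoeff_geometric:
  "pscoeff (geometric U) n = (if n > 0 then 0 else (\<Sum>i\<le>nat (- n). pscoeff (U ^ i) n))"
  by (simp add: geometric.rep_eq pscoeff_inverse)

text \<open>As \<open>U ^ i\<close> has order at most \<open>- i\<close>, the powers beyond
  \<open>K\<close> do not reach exponents above \<open>- int (Suc K)\<close>.\<close>

lemma order_le_geometric_diff:
  assumes "order_le U (- 1)"
  shows "order_le (geometric U - (\<Sum>i\<le>K. U ^ i)) (- int (Suc K))"
  unfolding order_le_def
proof (intro allI impI)
  fix n assume n: "n > - int (Suc K)"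
  have z: "pscoeff (U ^ i) n = 0" if "n > - int i" for i
    using order_le_power[OF assms, of i] that by (simp add: order_le_def)
  have "pscoeff (geometric U) n = (\<Sum>i\<le>K. pscoeff (U ^ i) n)"
  proof (cases "n > 0")
    case True
    then show ?thesis using z by (auto simp: pscoeff_geometric intro!: sum.neutral[symmetric])
  next
    case False
    then have "(\<Sum>i\<le>nat (- n). pscoeff (U ^ i) n) = (\<Sum>i\<le>K. pscoeff (U ^ i) n)"
      using n by (intro sum.mono_neutral_left) (auto intro!: z)
    then show ?thesis using False by (simp add: pscoeff_geometric)
  qed
  then show "pscoeff (geometric U - (\<Sum>i\<le>K. U ^ i)) n = 0" by (simp add: pscoeff_simps)
qed

text \<open>The partial sums telescope to \<open>1 - U ^ Suc K\<close>; this remainder and the tail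
  of the series have order tending to minus infinity. The product is noncommutative, so both sides
  are treated.\<close>

lemma one_minus_inverse:
  assumes U: "order_le U (- 1)"
  shows "(1 - U) * geometric U = 1" "geometric U * (1 - U) = 1"
proof -
  have T1: "(1 - U) * (\<Sum>i\<le>K. U ^ i) = 1 - U ^ Suc K" for K
  proof (induction K)
    case (Suc K)
    have "(1 - U) * (\<Sum>i\<le>Suc K. U ^ i) = 1 - U ^ Suc K + (1 - U) * U ^ Suc K"
      by (simp only: sum.atMost_Suc distrib_left Suc)
    then show ?case by (simp add: left_diff_distrib)
  qed simp
  have T2: "(\<Sum>i\<le>K. U ^ i) * (1 - U) = 1 - U ^ Suc K" for K
  proof (induction K)
    case (Suc K)
    have "(\<Sum>i\<le>Suc K. U ^ i) * (1 - U) = 1 - U ^ Suc K + U ^ Suc K * (1 - U)"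
      by (simp only: sum.atMost_Suc distrib_right Suc)
    then show ?case by (simp only: right_diff_distrib power_Suc2[of U "Suc K"]) simp
  qed simp
  have 1: "order_le (1 - U) 0"
    using order_le_diff[OF order_le_one order_le_mono[OF U]] by simp
  have p: "order_le (U ^ Suc K) (- int (Suc K))" for K
    using order_le_power[OF U, of "Suc K"] by (simp del: power_Suc)
  have "order_le ((1 - U) * geometric U - 1) (- int K)" for K
  proof -
    have "(1 - U) * geometric U - 1 = (1 - U) * (geometric U - (\<Sum>i\<le>K. U ^ i)) - U ^ Suc K"
      by (simp add: right_diff_distrib T1 del: power_Suc)
    moreover have "order_le \<dots> (- int (Suc K))"
      using order_le_mult[OF 1 order_le_geometric_diff[OF U, of K]] p
      by (intro order_le_diff) (simp_all del: power_Suc)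
    ultimately show ?thesis using order_le_mono by force
  qed
  then show "(1 - U) * geometric U = 1" using eq_zero_if_order_le by force
  have "order_le (geometric U * (1 - U) - 1) (- int K)" for K
  proof -
    have "geometric U * (1 - U) - 1 = (geometric U - (\<Sum>i\<le>K. U ^ i)) * (1 - U) - U ^ Suc K"
      by (simp add: left_diff_distrib T2 del: power_Suc)
    moreover have "order_le \<dots> (- int (Suc K))"
      using order_le_mult[OF order_le_geometric_diff[OF U, of K] 1] p
      by (intro order_le_diff) (simp_all del: power_Suc)
    ultimately show ?thesis using order_le_mono by force
  qed
  then show "geometric U * (1 - U) = 1" using eq_zero_if_order_le by force
qed

lemma order_le_geometric: "order_le (geometric U) 0"
  by (simp add: order_le_def pscoeff_geometric)

lemma supported_mod_geometric:
  assumes "supported_mod p 0 U"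
  shows "supported_mod p 0 (geometric U)"
  unfolding supported_mod_def
proof (intro allI impI)
  fix n assume "pscoeff (geometric U) n \<noteq> 0"
  then obtain i where "pscoeff (U ^ i) n \<noteq> 0"
    by (auto simp: pscoeff_geometric split: if_splits elim: sum.not_neutral_contains_not_neutral)
  then show "p dvd n - 0" using supported_mod_power[OF assms, of i] by (simp add: supported_mod_def)
qed

lemma inverse_psdiff_eqI:
  fixes P Q :: "'x psdiff"
  assumes "P * Q = 1" "Q * P = 1"
  shows "inverse P = Q"
proof -
  have "(THE R. P * R = 1 \<and> R * P = 1) = Q"
  proof (rule the_equality)
    fix R assume "P * R = 1 \<and> R * P = 1"
    then have "R = R * (P * Q)" "R * P = 1" using assms by simp_all
    then show "R = Q" by (metis mult.assoc mult_1_left)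
  qed (use assms in simp)
  then show ?thesis using assms by (auto simp: inverse_psdiff_def)
qed

section \<open>Derivations of pseudodifference operators\<close>

text \<open>Subtracting \<open>d 0\<close>, which vanishes for a derivation, keeps the orders bounded for all \<open>d\<close>.\<close>

lift_definition psder :: "('x dpoly \<Rightarrow> 'x dpoly) \<Rightarrow> 'x psdiff \<Rightarrow> 'x psdiff" is
  "\<lambda>d f n. d (f n) - d 0"
  by force

context
  fixes d :: "'x dpoly \<Rightarrow> 'x dpoly"
  assumes der: "diff_derivation d"
begin

lemmas d_simps =
  derivation_add[OF diff_derivation_derivation[OF der]]
  derivation_minus[OF diff_derivation_derivation[OF der]]
  derivation_zero[OF diff_derivation_derivation[OF der]]
  derivation_one[OF diff_derivation_derivation[OF der]]
  derivation_sum[OF diff_derivation_derivation[OF der]]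
  derivation_mult[OF diff_derivation_derivation[OF der]]
  diff_derivation_shift[OF der]

lemma pscoeff_psder: "pscoeff (psder d P) n = d (pscoeff P n)"
  by (simp add: psder.rep_eq d_simps)

lemma psder_diff: "psder d (P - Q) = psder d P - psder d Q"
  by (rule psdiff_eqI) (simp add: pscoeff_psder pscoeff_simps d_simps)

lemma psder_one: "psder d 1 = 0"
  by (rule psdiff_eqI) (simp add: pscoeff_psder pscoeff_simps d_simps)

lemma psder_pos_part: "psder d (pos_part P) = pos_part (psder d P)"
  by (rule psdiff_eqI) (simp add: pscoeff_psder pscoeff_simps d_simps)

lemma psder_mult: "psder d (P * Q) = psder d P * Q + P * psder d Q"
proof (rule psdiff_eqI)
  fix n
  obtain K where K: "\<forall>i>K. pscoeff P i = 0" "\<forall>i>K. pscoeff Q i = 0"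
    using pscoeff_common_bound by metis
  then have K': "\<forall>i>K. pscoeff (psder d P) i = 0" "\<forall>i>K. pscoeff (psder d Q) i = 0"
    by (simp_all add: pscoeff_psder d_simps)
  note bound = pscoeff_mult_bound[OF _ _ finite_atLeastAtMost_int subset_refl]
  show "pscoeff (psder d (P * Q)) n = pscoeff (psder d P * Q + P * psder d Q) n"
    unfolding pscoeff_psder plus_psdiff.rep_eq bound[OF K] bound[OF K'(1) K(2)] bound[OF K(1) K'(2)]
    by (simp add: d_simps pscoeff_psder sum.distrib)
qed

lemma psder_commutator:
  "psder d (commutator P Q) = commutator (psder d P) Q + commutator P (psder d Q)"
  by (simp add: commutator_def psder_diff psder_mult)

text \<open>The leading coefficient is the constant 1, which \<open>d\<close> kills.\<close>

lemma psder_lax_operator: "psder d (lax_operator e N p m) = deriv_lax_operator e N p m d"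
proof (rule psdiff_eqI)
  fix n
  have "d (if b then c else 0) = (if b then d c else 0)" for b c
    by (simp add: d_simps)
  then show "pscoeff (psder d (lax_operator e N p m)) n = pscoeff (deriv_lax_operator e N p m d) n"
    by (simp add: pscoeff_psder lax_operator_def deriv_lax_operator_def pscoeff_simps d_simps)
qed

text \<open>The commutator with \<open>A\<close> obeys the Leibniz rule too, so agreement on
  \<open>Y\<close> passes to its powers.\<close>

lemma psder_power_commutator:
  assumes "psder d Y = commutator A Y"
  shows "psder d (Y ^ n) = commutator A (Y ^ n)"
proof (induction n)
  case (Suc n)
  show ?case
    by (simp only: power_Suc psder_mult assms Suc commutator_def) (simp add: algebra_simps)
qed (simp add: psder_one commutator_def)

text \<open>Differentiating \<open>Y * Z = 1\<close> gives
  \<open>psder d Z = - (Z * psder d Y * Z)\<close>. This serves negative \<open>N\<close>, where the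
  hierarchy is built from powers of the inverse of \<open>L\<close>.\<close>

lemma psder_inverse_commutator:
  assumes Y: "psder d Y = commutator A Y" and inv: "Y * Z = 1" "Z * Y = 1"
  shows "psder d Z = commutator A Z"
proof -
  have "psder d Y * Z + Y * psder d Z = 0"
    using psder_mult[of Y Z] by (simp add: inv psder_one)
  then have "Z * (psder d Y * Z + Y * psder d Z) = 0" by simp
  then have "psder d Z + Z * psder d Y * Z = 0"
    by (simp add: distrib_left inv add.commute flip: mult.assoc)
  then have "psder d Z = - (Z * psder d Y * Z)" by (simp only: eq_neg_iff_add_eq_0)
  moreover have "Z * psder d Y * Z = Z * A * (Y * Z) - (Z * Y) * A * Z"
    by (simp add: Y commutator_def algebra_simps)
  ultimately show ?thesis by (simp add: inv commutator_def)
qed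

end

section \<open>Residues of commutators\<close>

text \<open>Telescoping: the operator \<open>shift n - 1\<close> is divisible by
  \<open>shift 1 - 1\<close> for either sign of \<open>n\<close>.\<close>

lemma shift_minus_self_in_range: "shift n f - f \<in> range (\<lambda>f. shift 1 f - f)"
proof (induction n rule: int_induct[of _ 0])
  case base
  show ?case by (auto intro: image_eqI[of _ _ 0])
next
  case (step1 i)
  then obtain g where g: "shift i f - f = shift 1 g - g" by auto
  have "shift (i + 1) f - f = (shift 1 (shift i f) - shift i f) + (shift i f - f)"
    by (simp add: shift_shift add.commute)
  also have "\<dots> = shift 1 (g + shift i f) - (g + shift i f)"
    by (simp only: g shift_add) simp
  finally show ?case by blast
next
  case (step2 i)
  then obtain g where g: "shift i f - f = shift 1 g - g" by auto
  let ?h = "shift (i - 1) f"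
  have "?h - f = (shift i f - f) - (shift 1 ?h - ?h)" by (simp add: shift_shift)
  also have "\<dots> = shift 1 (g - ?h) - (g - ?h)" by (simp only: g shift_diff) simp
  finally show ?case by blast
qed

lemma sum_in_range_shift:
  assumes "\<And>i. i \<in> I \<Longrightarrow> F i \<in> range (\<lambda>f. shift 1 f - f)"
  shows "(\<Sum>i\<in>I. F i) \<in> range (\<lambda>f. shift 1 f - f)"
proof -
  from assms have "\<exists>g. \<forall>i\<in>I. F i = shift 1 (g i) - g i" by (intro bchoice) auto
  then obtain g where "\<And>i. i \<in> I \<Longrightarrow> F i = shift 1 (g i) - g i" by blast
  then have "(\<Sum>i\<in>I. F i) = shift 1 (\<Sum>i\<in>I. g i) - (\<Sum>i\<in>I. g i)"
    by (simp add: shift_sum sum_subtractf)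
  then show ?thesis by blast
qed

text \<open>The coefficients of \<open>P\<close> at \<open>i\<close> and of \<open>Q\<close> at
  \<open>- i\<close> contribute \<open>?g i\<close> to the residue of \<open>Q * P\<close> and
  \<open>shift i (?g i)\<close> to that of \<open>P * Q\<close>.\<close>

lemma Res_commutator: "Res (commutator P Q) \<in> range (\<lambda>f. shift 1 f - f)"
proof -
  obtain K0 where K0: "\<forall>i>K0. pscoeff P i = 0" "\<forall>i>K0. pscoeff Q i = 0"
    using pscoeff_common_bound by metis
  define K where "K = max 0 K0"
  have K: "\<forall>i>K. pscoeff P i = 0" "\<forall>i>K. pscoeff Q i = 0"
    using K0 by (simp_all add: K_def)
  let ?g = "\<lambda>i. pscoeff Q (- i) * shift (- i) (pscoeff P i)"
  have "pscoeff (P * Q) 0 = (\<Sum>i\<in>{-K..K}. pscoeff P i * shift i (pscoeff Q (0 - i)))"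
    by (rule pscoeff_mult_bound[OF K]) auto
  then have PQ: "pscoeff (P * Q) 0 = (\<Sum>i\<in>{-K..K}. shift i (?g i))"
    by (simp add: shift_mult shift_shift mult.commute)
  have "pscoeff (Q * P) 0 = (\<Sum>i\<in>{-K..K}. pscoeff Q i * shift i (pscoeff P (0 - i)))"
    by (rule pscoeff_mult_bound[OF K(2,1)]) auto
  also have "\<dots> = (\<Sum>i\<in>{-K..K}. ?g i)"
    by (rule sum.reindex_bij_witness[of _ uminus uminus]) auto
  finally have "Res (commutator P Q) = (\<Sum>i\<in>{-K..K}. shift i (?g i) - ?g i)"
    by (simp add: Res_def commutator_def pscoeff_simps PQ sum_subtractf)
  then show ?thesis by (simp only: sum_in_range_shift shift_minus_self_in_range)
qed

section \<open>The hierarchy\<close>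

lemma jacobi_commutator:
  "commutator P (commutator Q R) - commutator Q (commutator P R) = commutator (commutator P Q) R"
  by (simp add: commutator_def algebra_simps)

lemma pos_part_diff: "pos_part (P - Q) = pos_part P - pos_part Q"
  by (rule psdiff_eqI) (simp add: pscoeff_simps)

lemma pos_part_order_ge: "order_ge P 0 \<Longrightarrow> pos_part P = P"
  by (rule psdiff_eqI) (simp add: pscoeff_simps order_ge_def)

lemma pos_part_order_le: "order_le P (- 1) \<Longrightarrow> pos_part P = 0"
  by (rule psdiff_eqI) (simp add: pscoeff_simps order_le_def)

lemma order_le_minus_pos_part: "order_le (P - pos_part P) (- 1)"
  by (simp add: order_le_def pscoeff_simps)

text \<open>Splitting both operators into nonnegative and negative parts,
  \<open>P * Q = Q * P\<close> reduces the difference of commutators to that of the nonnegative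
  parts minus that of the negative parts. The latter has order at most -2, so it has no nonnegative
  part.\<close>

lemma pos_part_commutators:
  assumes "P * Q = Q * P"
  shows "pos_part (commutator (pos_part P) Q) - pos_part (commutator (pos_part Q) P) =
    commutator (pos_part P) (pos_part Q)"
proof -
  let ?A = "pos_part P" and ?B = "pos_part Q"
  have "commutator ?A Q - commutator ?B P = commutator ?A ?B - commutator (P - ?A) (Q - ?B)"
    using assms by (simp add: commutator_def algebra_simps)
  then have "pos_part (commutator ?A Q) - pos_part (commutator ?B P) =
      pos_part (commutator ?A ?B) - pos_part (commutator (P - ?A) (Q - ?B))"
    by (simp flip: pos_part_diff)
  moreover have "order_ge (commutator ?A ?B) 0"
    using order_ge_mult[OF order_ge_pos_part order_ge_pos_part]
    unfolding commutator_def by (intro order_ge_diff) force+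
  moreover have "order_le (commutator (P - ?A) (Q - ?B)) (- 1 + - 1)"
    unfolding commutator_def by (intro order_le_diff order_le_mult order_le_minus_pos_part)
  then have "order_le (commutator (P - ?A) (Q - ?B)) (- 1)" by (rule order_le_mono) simp
  ultimately show ?thesis by (simp add: pos_part_order_ge pos_part_order_le)
qed

lemma pos_part_difference_operator: "pos_part P \<in> difference_operators"
proof -
  obtain K where "\<forall>i>K. pscoeff P i = 0" using pscoeff_bounded by blast
  then have "{n. pscoeff (pos_part P) n \<noteq> 0} \<subseteq> {0..K}"
    by (auto simp: pscoeff_simps not_less[symmetric])
  then show ?thesis
    unfolding difference_operators_def using finite_subset by blast
qed

section \<open>The operator \<open>L\<close> and the candidate flows\<close>

locale lax =
  fixes N p :: int and m :: nat and e :: "nat \<Rightarrow> 'x"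
  assumes bij: "bij_betw e {1..m} (UNIV :: 'x set)"
    and N: "N \<noteq> 0" and p: "p \<ge> 1" and m: "m \<ge> 1" and low: "N - int m * p < 0"
begin

definition "L = lax_operator e N p m"

text \<open>Of positive order \<open>\<bar>N\<bar>\<close> in both cases, so that the sign in the
  exponent is absorbed and only natural powers occur.\<close>

definition "X = (if N > 0 then L else inverse L)"

definition "q = p div gcd N p"

definition "P k = X ^ (nat q * k)"

definition "A k = pos_part (P k)"

definition "C k = commutator (A k) L"

text \<open>The values on the generators are read off from \<open>C k\<close>;
  \<open>inv_into\<close> recovers the index of a generator from its label, and commutation with the
  shift dictates the remaining values.\<close>

definition "D k = deriv_ext (\<lambda>(x, j).
  shift j (pscoeff (C k) (N - int (inv_into {1..m} e x) * p)))"

lemma p_nonzero [simp]: "p \<noteq> 0"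
  using p by simp

lemma pscoeff_lax_sum:
  assumes "i \<in> {1..m}"
  shows "pscoeff (\<Sum>i = 1..m. psmono (c i) (N - int i * p)) (N - int i * p) = c i"
  using assms by (simp add: pscoeff_simps)

lemma pscoeff_L:
  assumes "i \<in> {1..m}"
  shows "pscoeff L (N - int i * p) = dvar (e i) 0"
proof -
  have "N - int i * p \<noteq> N" using assms p by simp
  then show ?thesis
    using pscoeff_lax_sum[OF assms] by (simp add: L_def lax_operator_def plus_psdiff.rep_eq psmono.rep_eq)
qed

lemma order_le_lax_sum: "order_le (\<Sum>i = 1..m. psmono (c i) (N - int i * p)) (N - p)"
proof (intro order_le_sum order_le_mono[OF order_le_psmono])
  fix i assume "i \<in> {1..m}"
  then have "1 * p \<le> int i * p" using p by (intro mult_right_mono) auto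
  then show "N - int i * p \<le> N - p" by simp
qed

lemma supported_mod_lax_sum: "supported_mod p N (\<Sum>i = 1..m. psmono (c i) (N - int i * p))"
  by (intro supported_mod_sum supported_mod_psmono) simp

lemma order_le_L: "order_le L N"
  unfolding L_def lax_operator_def
  by (intro order_le_add order_le_psmono order_le_mono[OF order_le_lax_sum]) (use p in simp)

lemma supported_mod_L: "supported_mod p N L"
  unfolding L_def lax_operator_def
  by (intro supported_mod_add supported_mod_psmono supported_mod_lax_sum) simp

lemma order_ge_L: "order_ge L (N - int m * p)"
  unfolding order_ge_def
proof (intro allI impI)
  fix n assume n: "n < N - int m * p"
  have "n \<noteq> N - int i * p" if "i \<le> m" for i
    using n mult_right_mono[of "int i" "int m" p] that p by auto
  moreover have "0 \<le> int m * p" using p by simp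
  then have "n \<noteq> N" using n by linarith
  ultimately show "pscoeff L n = 0"
    by (auto simp: L_def lax_operator_def pscoeff_simps intro!: sum.neutral)
qed

text \<open>Factoring out the leading term gives \<open>L = psmono 1 N * (1 - U)\<close>, where
  \<open>U\<close> has negative order and exponents divisible by \<open>p\<close>; the geometric
  series inverts the second factor and keeps this support.\<close>

lemma L_inverse:
  shows "L * inverse L = 1" "inverse L * L = 1" "order_le (inverse L) (- N)"
    and "supported_mod p (- N) (inverse L)"
proof -
  define W where "W = (\<Sum>i = 1..m. psmono (dvar (e i) 0) (N - int i * p))"
  define U where "U = - (psmono 1 (- N) * W)"
  define M where "M = geometric U * psmono 1 (- N)"
  have "order_le (psmono 1 (- N) * W) (- N + (N - p))"
    unfolding W_def by (intro order_le_mult order_le_psmono order_le_lax_sum)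
  then have U: "order_le U (- 1)"
    unfolding U_def using p by (intro order_le_uminus) (auto elim: order_le_mono)
  have "supported_mod p (- N + N) (psmono 1 (- N) * W)"
    unfolding W_def by (intro supported_mod_mult supported_mod_psmono supported_mod_lax_sum) simp
  then have U': "supported_mod p 0 U"
    unfolding U_def by (intro supported_mod_uminus) simp
  have "psmono 1 N * (psmono 1 (- N) * W) = W"
    by (simp add: psmono_one_inverse flip: mult.assoc)
  then have L: "L = psmono 1 N * (1 - U)"
    unfolding L_def lax_operator_def W_def[symmetric] U_def by (simp add: distrib_left)
  have "L * M = psmono 1 N * ((1 - U) * geometric U) * psmono 1 (- N)"
    by (simp add: L M_def mult.assoc)
  then have right_inv: "L * M = 1" by (simp add: one_minus_inverse[OF U] psmono_one_inverse)
  have "M * L = geometric U * (psmono 1 (- N) * psmono 1 N) * (1 - U)"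
    by (simp add: L M_def mult.assoc)
  then have left_inv: "M * L = 1" by (simp add: one_minus_inverse[OF U] psmono_one_inverse)
  have "inverse L = M" by (rule inverse_psdiff_eqI[OF right_inv left_inv])
  moreover have "order_le M (0 + - N)"
    unfolding M_def by (intro order_le_mult order_le_geometric order_le_psmono)
  moreover have "supported_mod p (0 + - N) M"
    unfolding M_def by (intro supported_mod_mult supported_mod_geometric U' supported_mod_psmono) simp
  ultimately show "L * inverse L = 1" "inverse L * L = 1" "order_le (inverse L) (- N)"
    "supported_mod p (- N) (inverse L)"
    using right_inv left_inv by simp_all
qed

section \<open>Powers of \<open>L\<close> and the residue class of their exponents\<close>

lemma q_pos: "q \<ge> 1"
proof -
  have "gcd N p > 0" "gcd N p \<le> p" using p by (auto intro: zdvd_imp_le)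
  then show ?thesis by (simp add: q_def pos_imp_zdiv_pos_iff int_one_le_iff_zero_less)
qed

text \<open>The reason for the choice of \<open>q\<close>: it makes the order of every
  \<open>P k\<close> a multiple of \<open>p\<close>.\<close>

lemma q_mult_N: "q * N = (N div gcd N p) * p"
  by (simp add: q_def div_mult_swap dvd_div_mult mult.commute)

lemma L_powi: "L powi (sgn N * q * int k) = P k"
proof (cases "N > 0")
  case True
  then show ?thesis using q_pos by (simp add: P_def X_def power_int_def nat_mult_distrib)
next
  case False
  then show ?thesis
  \<comment> \<open>For negative \<open>N\<close> the exponent is negative exactly when
    \<open>k\<close> is positive, and only then does \<open>power_int\<close> use the
    inverse.\<close>
  proof (cases "k = 0")
    case False
    then have "\<not> sgn N * q * int k \<ge> 0" using \<open>\<not> N > 0\<close> N q_pos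
      by (simp add: mult_neg_pos not_le)
    then show ?thesis using \<open>\<not> N > 0\<close> N q_pos
      by (simp add: P_def X_def power_int_def nat_mult_distrib)
  qed (simp add: P_def power_int_def)
qed

lemma X_commutes: "X * L = L * X"
  by (simp add: X_def L_inverse)

lemma P_commutes_L: "P k * L = L * P k"
  unfolding P_def by (rule power_commuting_commutes[OF X_commutes])

lemma P_commutes: "P k * P l = P l * P k"
  unfolding P_def power_add[symmetric] by (simp only: add.commute)

lemma supported_mod_P: "supported_mod p 0 (P k)"
proof -
  have "supported_mod p \<bar>N\<bar> X"
    using supported_mod_L L_inverse(4) by (simp add: X_def)
  from supported_mod_power[OF this, of "nat q * k"]
  have *: "supported_mod p (int (nat q * k) * \<bar>N\<bar>) (P k)"
    by (simp only: P_def)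
  have "p dvd \<bar>q * N\<bar>" unfolding q_mult_N by simp
  then have "p dvd q * \<bar>N\<bar> * int k" using q_pos by (simp add: abs_mult)
  moreover have "int (nat q * k) * \<bar>N\<bar> = q * \<bar>N\<bar> * int k" using q_pos by simp
  ultimately have "p dvd int (nat q * k) * \<bar>N\<bar>" by (simp only:)
  then show ?thesis using supported_mod_cong[OF *] by simp
qed

section \<open>Well-definedness of the flows\<close>

lemma C_eq: "C k = commutator (A k - P k) L"
  by (simp add: C_def commutator_def algebra_simps P_commutes_L)

lemma supported_mod_A: "supported_mod p 0 (A k)"
  unfolding A_def by (intro supported_mod_pos_part supported_mod_P)

text \<open>Only negative exponents remain, and all are divisible by \<open>p\<close>; this improves
  the bound from -1 to \<open>- p\<close>.\<close>

lemma order_le_A_minus_P: "order_le (A k - P k) (- p)"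
  unfolding order_le_def
proof (intro allI impI, rule ccontr)
  fix i assume i: "i > - p" and nz: "pscoeff (A k - P k) i \<noteq> 0"
  have "p dvd i - 0"
    using supported_mod_diff[OF supported_mod_A supported_mod_P] nz unfolding supported_mod_def by blast
  then have "p dvd - i" by simp
  moreover have "i < 0" using nz by (auto simp: A_def pscoeff_simps split: if_splits)
  ultimately have "p \<le> - i" by (intro zdvd_imp_le) auto
  then show False using i by simp
qed

text \<open>The form \<open>commutator (A k) L\<close> bounds the exponents below by
  \<open>N - int m * p\<close>, the form \<open>commutator (A k - P k) L\<close> bounds them above
  by \<open>N - p\<close>, and all are congruent to \<open>N\<close> modulo
  \<open>p\<close>.\<close>

lemma C_expansion: "C k = (\<Sum>i = 1..m. psmono (pscoeff (C k) (N - int i * p)) (N - int i * p))"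
proof (rule psdiff_eqI)
  fix n
  show "pscoeff (C k) n =
    pscoeff (\<Sum>i = 1..m. psmono (pscoeff (C k) (N - int i * p)) (N - int i * p)) n"
  proof (cases "\<exists>i\<in>{1..m}. n = N - int i * p")
    case True
    then obtain i where "i \<in> {1..m}" "n = N - int i * p" by blast
    then show ?thesis by (simp only: pscoeff_lax_sum)
  next
    case False
    have "pscoeff (C k) n = 0"
    proof (rule ccontr)
      assume nz: "pscoeff (C k) n \<noteq> 0"
      have "supported_mod p (0 + N) (A k * L)" "supported_mod p (N + 0) (L * A k)"
        by (intro supported_mod_mult supported_mod_A supported_mod_L)+
      then have "supported_mod p N (C k)"
        unfolding C_def commutator_def by (intro supported_mod_diff) simp_all
      then have "p dvd n - N" using nz by (simp add: supported_mod_def)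
      then obtain t where "n - N = p * t" by (elim dvdE)
      \<comment> \<open>The index of the exponent is \<open>- t\<close>; the two order bounds place
        it between 1 and \<open>m\<close>.\<close>
      then have t: "n = N - (- t) * p" by (simp add: algebra_simps)
      have "order_ge (A k * L) (0 + (N - int m * p))" "order_ge (L * A k) ((N - int m * p) + 0)"
        unfolding A_def by (intro order_ge_mult order_ge_L order_ge_pos_part)+
      then have "order_ge (C k) (N - int m * p)"
        unfolding C_def commutator_def by (intro order_ge_diff) simp_all
      then have "\<not> n < N - int m * p" using nz by (auto simp: order_ge_def)
      then have "(- t) * p \<le> int m * p" using t by linarith
      then have 1: "- t \<le> int m" by (rule mult_right_le_imp_le) (use p in simp)
      have "order_le ((A k - P k) * L) (- p + N)" "order_le (L * (A k - P k)) (N + - p)"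
        by (intro order_le_mult order_le_A_minus_P order_le_L)+
      then have "order_le (C k) (N - p)"
        unfolding C_eq commutator_def by (intro order_le_diff) simp_all
      then have "\<not> n > N - p" using nz by (auto simp: order_le_def)
      then have "1 * p \<le> (- t) * p" using t by linarith
      then have 2: "1 \<le> - t" by (rule mult_right_le_imp_le) (use p in simp)
      from 1 2 have "nat (- t) \<in> {1..m}" "n = N - int (nat (- t)) * p" using t by auto
      then show False using False by blast
    qed
    moreover have "pscoeff (\<Sum>i = 1..m. psmono (c i) (N - int i * p)) n = 0" for c
      using False by (auto simp: pscoeff_simps intro!: sum.neutral)
    ultimately show ?thesis by simp
  qed
qed

lemma diff_derivation_D: "diff_derivation (D k)"
  unfolding D_def by (rule diff_derivation_deriv_ext)

lemma D_dvar:
  assumes "i \<in> {1..m}"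
  shows "D k (dvar (e i) 0) = pscoeff (C k) (N - int i * p)"
  using bij_betw_inv_into_left[OF bij assms] by (simp add: D_def deriv_ext_dvar)

lemma deriv_lax_operator_D: "deriv_lax_operator e N p m (D k) = C k"
proof -
  have "deriv_lax_operator e N p m (D k) =
      (\<Sum>i = 1..m. psmono (pscoeff (C k) (N - int i * p)) (N - int i * p))"
    unfolding deriv_lax_operator_def by (intro sum.cong refl) (simp add: D_dvar)
  then show ?thesis using C_expansion[of k] by simp
qed

lemma generator_cases: obtains i where "i \<in> {1..m}" "x = e i"
  using bij by (metis UNIV_I bij_betw_imp_surj_on imageE)

text \<open>The exponents in the expansion are distinct, so the Lax equation fixes each value on a
  generator, and these determine the derivation.\<close>

lemma D_unique:
  assumes d: "diff_derivation d" and "deriv_lax_operator e N p m d = C k"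
  shows "d = D k"
proof (rule diff_derivation_eqI[OF d diff_derivation_D])
  fix x
  obtain i where i: "i \<in> {1..m}" "x = e i" by (rule generator_cases)
  have "d (dvar (e i) 0) = pscoeff (deriv_lax_operator e N p m d) (N - int i * p)"
    unfolding deriv_lax_operator_def using pscoeff_lax_sum[OF i(1)] by metis
  then show "d (dvar x 0) = D k (dvar x 0)" using assms i by (simp add: D_dvar)
qed

section \<open>Zero curvature, commutativity and conserved densities\<close>

lemma psder_D_L: "psder (D k) L = commutator (A k) L"
  by (simp add: L_def psder_lax_operator[OF diff_derivation_D] deriv_lax_operator_D C_def)

lemma psder_D_P: "psder (D k) (P l) = commutator (A k) (P l)"
  unfolding P_def
  using psder_power_commutator[OF diff_derivation_D] psder_D_L
    psder_inverse_commutator[OF diff_derivation_D psder_D_L L_inverse(1,2)]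
  by (simp add: X_def)

text \<open>The flow acts on \<open>P l\<close> as a commutator and commutes with taking nonnegative
  parts, so the commuting of \<open>P k\<close> and \<open>P l\<close> yields the Zakharov-Shabat
  equation.\<close>

lemma zero_curvature: "psder (D k) (A l) - psder (D l) (A k) = commutator (A k) (A l)"
  using pos_part_commutators[OF P_commutes, of k l]
  by (simp add: A_def psder_pos_part[OF diff_derivation_D] psder_D_P)

lemma D_commute: "D k \<circ> D l = D l \<circ> D k"
proof -
  note dd = diff_derivation_D
  have flow: "psder (D k) (psder (D l) L) = commutator (psder (D k) (A l)) L +
      commutator (A l) (commutator (A k) L)" for k l
    by (simp add: psder_D_L psder_commutator[OF dd])
  have "psder (D k) (psder (D l) L) - psder (D l) (psder (D k) L) =
      commutator (psder (D k) (A l) - psder (D l) (A k)) L +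
      (commutator (A l) (commutator (A k) L) - commutator (A k) (commutator (A l) L))"
    by (simp only: flow) (simp add: commutator_def algebra_simps)
  \<comment> \<open>Zero curvature turns the first term into the commutator of
    \<open>commutator (A k) (A l)\<close> with \<open>L\<close>, and the Jacobi identity turns the
    second into its negative.\<close>
  also have "\<dots> = 0"
    by (simp only: zero_curvature jacobi_commutator) (simp add: commutator_def algebra_simps)
  finally have eq: "psder (D k) (psder (D l) L) = psder (D l) (psder (D k) L)" by simp
  have "(\<lambda>f. D k (D l f) - D l (D k f)) = (\<lambda>_. 0)"
  proof (rule diff_derivation_eqI[OF diff_derivation_commutator[OF dd dd] diff_derivation_zero])
    fix x
    obtain i where i: "i \<in> {1..m}" "x = e i" by (rule generator_cases)
    have "D k (D l (dvar x 0)) = pscoeff (psder (D k) (psder (D l) L)) (N - int i * p)" for k l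
      by (simp add: pscoeff_psder[OF dd] pscoeff_L[OF i(1)] i(2))
    then show "D k (D l (dvar x 0)) - D l (D k (dvar x 0)) = 0" by (simp add: eq)
  qed
  then show ?thesis by (simp add: fun_eq_iff)
qed

text \<open>A flow acts coefficientwise, so this derivative is the residue of
  \<open>commutator (A k) (P l)\<close>.\<close>

lemma D_Res: "D k (Res (P l)) \<in> range (\<lambda>f. shift 1 f - f)"
  using Res_commutator[of "A k" "P l"]
  by (simp add: Res_def pscoeff_psder[OF diff_derivation_D, symmetric] psder_D_P)

section \<open>Specialisation to the last generator\<close>

definition "x_last = e m"

lemma pscoeff_L_mult: "pscoeff (L * Y) r = shift N (pscoeff Y (r - N)) +
    (\<Sum>i = 1..m. dvar (e i) 0 * shift (N - int i * p) (pscoeff Y (r - (N - int i * p))))"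
  by (simp only: L_def lax_operator_def distrib_right sum_distrib_right plus_psdiff.rep_eq
      pscoeff_sum pscoeff_psmono_mult mult_1_left)

text \<open>Under the specialisation only the leading and the lowest term of \<open>L\<close>
  survive; the lowest one contributes one factor of the indeterminate.\<close>

lemma coeff_sum_L_mult:
  "coeff_sum x_last (Suc j) (pscoeff (L * Y) r) =
    coeff_sum x_last (Suc j) (pscoeff Y (r - N)) + coeff_sum x_last j (pscoeff Y (r - (N - int m * p)))"
  (is ?suc)
  and coeff_sum_0_L_mult:
  "coeff_sum x_last 0 (pscoeff (L * Y) r) = coeff_sum x_last 0 (pscoeff Y (r - N))"
proof -
  have eq: "e i = x_last \<longleftrightarrow> i = m" if "i \<in> {1..m}" for i
    unfolding x_last_def
    by (rule inj_on_eq_iff[OF bij_betw_imp_inj_on[OF bij]]) (use that m in auto)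
  have "(\<Sum>i = 1..m. coeff_sum x_last (Suc j)
          (dvar (e i) 0 * shift (N - int i * p) (pscoeff Y (r - (N - int i * p))))) =
      (\<Sum>i = 1..m. if i = m then coeff_sum x_last j (pscoeff Y (r - (N - int m * p))) else 0)"
    by (intro sum.cong refl) (simp add: coeff_sum_dvar_mult coeff_sum_shift eq)
  also have "\<dots> = coeff_sum x_last j (pscoeff Y (r - (N - int m * p)))"
    using m by simp
  finally show ?suc
    by (simp only: pscoeff_L_mult coeff_sum_add coeff_sum_sum coeff_sum_shift)
  show "coeff_sum x_last 0 (pscoeff (L * Y) r) = coeff_sum x_last 0 (pscoeff Y (r - N))"
    by (simp add: pscoeff_L_mult coeff_sum_add coeff_sum_sum coeff_sum_shift coeff_sum_0_dvar_mult)
qed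

text \<open>Multiplication by \<open>L\<close> gives Pascal's rule for these numbers, also downwards from \<open>n = 0\<close> when
  \<open>N < 0\<close>; their values are the binomial coefficients of \<open>j\<close> in \<open>\<plusminus> n\<close>.\<close>

definition "power_coeff n j = coeff_sum x_last j (pscoeff (X ^ n) (int n * \<bar>N\<bar> - int j * int m * p))"

lemma power_coeff_0: "power_coeff 0 j = (if j = 0 then 1 else 0)"
  using m p by (simp add: power_coeff_def pscoeff_one coeff_sum_one)

lemma power_coeff_pos:
  assumes "N > 0"
  shows "power_coeff n j = of_nat (n choose j)"
proof (induction n arbitrary: j)
  case 0
  show ?case by (cases j) (simp_all add: power_coeff_0)
next
  case (Suc n)
  have X: "X ^ Suc n = L * X ^ n" using assms by (simp add: X_def)
  show ?case
  proof (cases j)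
    case 0
    have "power_coeff (Suc n) 0 = power_coeff n 0"
      unfolding power_coeff_def X coeff_sum_0_L_mult using assms by (simp add: algebra_simps)
    then show ?thesis using 0 Suc by simp
  next
    case (Suc i)
    \<comment> \<open>The leading term of \<open>L\<close> lowers \<open>n\<close> alone, the lowest
      term lowers both \<open>n\<close> and the degree: Pascal's rule.\<close>
    have "int (Suc n) * \<bar>N\<bar> - int (Suc i) * int m * p - N = int n * \<bar>N\<bar> - int (Suc i) * int m * p"
      "int (Suc n) * \<bar>N\<bar> - int (Suc i) * int m * p - (N - int m * p) = int n * \<bar>N\<bar> - int i * int m * p"
      using assms by (simp_all add: algebra_simps)
    then have "power_coeff (Suc n) (Suc i) = power_coeff n (Suc i) + power_coeff n i"
      unfolding power_coeff_def X coeff_sum_L_mult by (simp only:)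
    then show ?thesis using Suc Suc.IH by simp
  qed
qed

text \<open>Here \<open>X ^ n = L * X ^ Suc n\<close>, so Pascal's rule is solved for the row
  \<open>Suc n\<close>. The values are the coefficients of the power of a binomial with exponent
  \<open>- (n + 1)\<close>.\<close>

lemma power_coeff_neg:
  assumes "N < 0"
  shows "power_coeff (Suc n) j = (- 1) ^ j * of_nat ((n + j) choose j)"
proof -
  have X: "X ^ n = L * X ^ Suc n" for n
    using assms by (simp add: X_def L_inverse flip: mult.assoc)
  have zero: "power_coeff (Suc n) 0 = power_coeff n 0" for n
  proof -
    have "power_coeff n 0 = coeff_sum x_last 0 (pscoeff (L * X ^ Suc n) (int n * \<bar>N\<bar>))"
      using X[of n] by (simp add: power_coeff_def)
    moreover have "int n * \<bar>N\<bar> - N = int (Suc n) * \<bar>N\<bar>"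
      using assms by (simp add: algebra_simps)
    ultimately show ?thesis
      by (simp only: coeff_sum_0_L_mult) (simp add: power_coeff_def)
  qed
  have suc: "power_coeff (Suc n) (Suc i) = power_coeff n (Suc i) - power_coeff (Suc n) i" for n i
  proof -
    have eq: "int n * \<bar>N\<bar> - int (Suc i) * int m * p - N = int (Suc n) * \<bar>N\<bar> - int (Suc i) * int m * p"
      "int n * \<bar>N\<bar> - int (Suc i) * int m * p - (N - int m * p) = int (Suc n) * \<bar>N\<bar> - int i * int m * p"
      using assms by (simp_all add: algebra_simps)
    have "power_coeff n (Suc i) =
        coeff_sum x_last (Suc i) (pscoeff (L * X ^ Suc n) (int n * \<bar>N\<bar> - int (Suc i) * int m * p))"
      using X[of n] by (simp only: power_coeff_def)
    then have "power_coeff n (Suc i) = power_coeff (Suc n) (Suc i) + power_coeff (Suc n) i"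
      unfolding power_coeff_def coeff_sum_L_mult eq .
    then show ?thesis by simp
  qed
  show ?thesis
  proof (induction n arbitrary: j)
    case 0
    show ?case by (induction j) (simp_all add: zero suc power_coeff_0)
  next
    case IH: (Suc n)
    show ?case
    \<comment> \<open>The recursion refers to the previous row and to the preceding entry of the
      same row, hence the inner induction.\<close>
    proof (induction j)
      case 0
      show ?case using IH[of 0] zero by simp
    next
      case (Suc i)
      have "power_coeff (Suc (Suc n)) (Suc i) = power_coeff (Suc n) (Suc i) - power_coeff (Suc (Suc n)) i"
        by (rule suc)
      then show ?case by (simp add: Suc IH algebra_simps)
    qed
  qed
qed

section \<open>Nonvanishing residues and unbounded degrees\<close>

definition "w = nat (\<bar>N\<bar> div gcd N p)"

lemma w_pos: "w \<ge> 1"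
proof -
  have "gcd N p > 0" "gcd N p \<le> \<bar>N\<bar>" using N by (auto intro: zdvd_imp_le)
  then have "\<bar>N\<bar> div gcd N p > 0" by (simp add: pos_imp_zdiv_pos_iff)
  then show ?thesis by (simp add: w_def)
qed

lemma q_mult_abs_N: "q * \<bar>N\<bar> = int w * p"
proof -
  have "gcd N p dvd p" "gcd N p dvd \<bar>N\<bar>" by simp_all
  then obtain a b where ab: "p = gcd N p * a" "\<bar>N\<bar> = gcd N p * b" by (elim dvdE)
  have g: "gcd N p > 0" using N by simp
  then have "q = a" using ab(1) by (metis nonzero_mult_div_cancel_left q_def less_irrefl)
  moreover have "\<bar>N\<bar> div gcd N p = b"
    using ab(2) g by (metis nonzero_mult_div_cancel_left less_irrefl)
  then have "int w = b" using w_pos by (simp add: w_def)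
  ultimately show ?thesis using ab by (metis mult.assoc mult.commute)
qed

text \<open>The power has order \<open>int (w * l) * int m * p\<close>, and each factor of the last
  generator lowers the exponent by \<open>int m * p\<close>; thus exponent 0 is reached in degree
  \<open>w * l\<close>, with a nonzero binomial coefficient.\<close>

lemma coeff_sum_Res_nonzero:
  assumes "l \<ge> 1"
  shows "coeff_sum x_last (w * l) (Res (P (m * l))) \<noteq> 0"
proof -
  define n where "n = nat q * (m * l)"
  have n: "int n = q * int m * int l" using q_pos by (simp add: n_def)
  have "int n * \<bar>N\<bar> = (q * \<bar>N\<bar>) * int m * int l" by (simp add: n)
  then have "int n * \<bar>N\<bar> = int (w * l) * int m * p"
    unfolding q_mult_abs_N by simp
  then have eq: "coeff_sum x_last (w * l) (Res (P (m * l))) = power_coeff n (w * l)"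
    by (simp only: power_coeff_def Res_def P_def n_def[symmetric] diff_self)
  show ?thesis
  proof (cases "N > 0")
    case True
    \<comment> \<open>For positive \<open>N\<close> the binomial coefficient is nonzero only if
      \<open>w * l \<le> n\<close>, which follows from \<open>N < int m * p\<close>.\<close>
    have "int w * p = q * N" using q_mult_abs_N True by simp
    also have "\<dots> \<le> q * (int m * p)" using low q_pos by (intro mult_left_mono) auto
    finally have "int w * p \<le> (q * int m) * p" by simp
    then have "int w \<le> q * int m" by (rule mult_right_le_imp_le) (use p in simp)
    then have "int w * int l \<le> q * int m * int l" by (rule mult_right_mono) simp
    then have "w * l \<le> n" using n by (simp flip: of_nat_mult)
    then show ?thesis by (simp add: eq power_coeff_pos[OF True] not_less)
  next
    case False
    then have "N < 0" using N by simp
    have "n > 0" using assms m q_pos by (simp add: n_def)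
    then obtain n' where "n = Suc n'" by (cases n) auto
    then show ?thesis by (simp add: eq power_coeff_neg[OF \<open>N < 0\<close>])
  qed
qed

text \<open>This is the coefficient of the commutator at its lowest exponent, where only the residue
  of \<open>P k\<close> meets the lowest coefficient of \<open>L\<close>.\<close>

lemma D_last_generator:
  "D k (dvar x_last 0) = dvar x_last 0 * (Res (P k) - shift (N - int m * p) (Res (P k)))"
proof -
  have u: "pscoeff L (N - int m * p) = dvar x_last 0" using pscoeff_L m by (simp add: x_last_def)
  have A: "pscoeff (A k) 0 = Res (P k)" by (simp add: A_def Res_def pscoeff_simps)
  have "D k (dvar x_last 0) = pscoeff (A k * L) (0 + (N - int m * p)) -
      pscoeff (L * A k) ((N - int m * p) + 0)"
    using D_dvar[of m k] m by (simp add: x_last_def C_def commutator_def pscoeff_simps)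
  also have "\<dots> = Res (P k) * dvar x_last 0 - dvar x_last 0 * shift (N - int m * p) (Res (P k))"
    using pscoeff_mult_lowest[OF order_ge_pos_part order_ge_L, of "P k"]
      pscoeff_mult_lowest[OF order_ge_L order_ge_pos_part, of "P k"]
    by (simp only: A_def[symmetric] u A) simp
  finally show ?thesis by (simp add: algebra_simps)
qed

text \<open>The difference of the residue and its shift has moment sum
  \<open>- (N - int m * p) * (w * l)\<close> times a nonzero coefficient sum; the outer generator
  raises the degree by one.\<close>

lemma mdeg_D_last_generator:
  assumes "l \<ge> 1"
  shows "Suc (w * l) \<in> mdeg ` Poly_Mapping.keys (D (m * l) (dvar x_last 0))"
proof (rule moment_sum_nonzero)
  have "moment_sum x_last (Suc (w * l)) (D (m * l) (dvar x_last 0)) =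
      - of_int ((N - int m * p) * int (w * l)) * coeff_sum x_last (w * l) (Res (P (m * l)))"
    unfolding D_last_generator moment_sum_dvar_mult moment_sum_diff moment_sum_shift by simp
  moreover have "(N - int m * p) * int (w * l) \<noteq> 0"
    using low w_pos assms by simp
  then have "- (of_int ((N - int m * p) * int (w * l)) :: complex) \<noteq> 0"
    by (simp only: neg_equal_0_iff_equal of_int_eq_0_iff) simp
  ultimately show "moment_sum x_last (Suc (w * l)) (D (m * l) (dvar x_last 0)) \<noteq> 0"
    using coeff_sum_Res_nonzero[OF assms] by simp
qed

text \<open>A finite spanning set would leave only finitely many monomials for the values at the
  last generator, while their degrees are unbounded.\<close>

lemma D_infinite_dimensional:
  "\<not> (\<exists>B. finite B \<and> endo.span B = endo.span (D ` {1..}))"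
proof
  assume "\<exists>B. finite B \<and> endo.span B = endo.span (D ` {1..})"
  then obtain B where B: "finite B" "endo.span B = endo.span (D ` {1..})" by blast
  define K where "K = (\<Union>b\<in>B. Poly_Mapping.keys (b (dvar x_last 0)))"
  let ?S = "{f :: 'x dpoly \<Rightarrow> 'x dpoly. Poly_Mapping.keys (f (dvar x_last 0)) \<subseteq> K}"
  have "endo.subspace ?S"
  proof (rule endo.subspaceI)
    fix f g assume "f \<in> ?S" "g \<in> ?S"
    then show "f + g \<in> ?S"
      using Poly_Mapping.keys_add[of "f (dvar x_last 0)" "g (dvar x_last 0)"] by auto
  next
    fix c f assume "f \<in> ?S"
    then show "endo_scale c f \<in> ?S"
      using keys_dscale[of c "f (dvar x_last 0)"] by (auto simp: endo_scale_def)
  qed simp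
  moreover have "B \<subseteq> ?S" by (auto simp: K_def)
  ultimately have "endo.span B \<subseteq> ?S" by (intro endo.span_minimal)
  then have keys: "Poly_Mapping.keys (D k (dvar x_last 0)) \<subseteq> K" if "k \<ge> 1" for k
    using that endo.span_base[of "D k" "D ` {1..}"] by (auto simp: B(2))
  have "finite (mdeg ` K)" using B(1) by (simp add: K_def)
  then obtain b where b: "\<And>n. n \<in> mdeg ` K \<Longrightarrow> n < b"
    by (auto simp: finite_nat_set_iff_bounded)
  \<comment> \<open>The flow with index \<open>m * Suc b\<close> contains a monomial of degree
    beyond the bound \<open>b\<close>, because \<open>w\<close> is at least 1.\<close>
  have "Suc (w * Suc b) \<in> mdeg ` K"
    using mdeg_D_last_generator[of "Suc b"] keys[of "m * Suc b"] m by auto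
  then have "Suc (w * Suc b) < b" by (rule b)
  moreover have "1 * Suc b \<le> w * Suc b" using w_pos by (rule mult_right_mono) simp
  ultimately show False by simp
qed

end

theorem mainTheorem2:
  fixes N p q \<epsilon> :: int and m :: nat and e :: "nat \<Rightarrow> 'x" and L :: "'x psdiff"
  assumes "bij_betw e {1..m} (UNIV :: 'x set)"
    and "N \<noteq> 0" and "p \<ge> 1" and "m \<ge> 1" and "N - int m * p < 0"
    and "L = lax_operator e N p m"
    and "q = p div gcd N p" and "\<epsilon> = sgn N"
  shows "\<exists>D :: nat \<Rightarrow> 'x dpoly \<Rightarrow> 'x dpoly.
      (\<forall>k\<ge>1. \<forall>d. diff_derivation d \<and>
          deriv_lax_operator e N p m d = commutator (pos_part (L powi (\<epsilon> * q * int k))) L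
          \<longleftrightarrow> d = D k) \<and>
      (\<forall>k\<ge>1. lax_flow e N p m (D k)) \<and>
      (\<forall>k\<ge>1. \<forall>k'\<ge>1. D k \<circ> D k' = D k' \<circ> D k) \<and>
      \<not> (\<exists>B. finite B \<and> endo.span B = endo.span (D ` {1..})) \<and>
      (\<forall>k\<ge>1. \<forall>k'\<ge>1. D k (Res (L powi (\<epsilon> * q * int k'))) \<in> range (\<lambda>f. shift 1 f - f))"
proof -
  interpret H: lax N p m e by unfold_locales (use assms in auto)
  have L: "L = H.L" by (simp add: H.L_def assms)
  have P: "L powi (\<epsilon> * q * int k) = H.P k" for k
    using H.L_powi[of k] by (simp add: L assms H.q_def)
  have C: "commutator (pos_part (H.P k)) L = H.C k" for k
    by (simp add: L H.C_def H.A_def)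
  have flow: "lax_flow e N p m (H.D k)" for k
    unfolding lax_flow_def
    using H.diff_derivation_D H.deriv_lax_operator_D pos_part_difference_operator
    by (auto simp: H.C_def H.A_def H.L_def)
  show ?thesis
    unfolding P C
  proof (intro exI[of _ H.D] conjI allI impI)
    fix k d
    show "diff_derivation d \<and> deriv_lax_operator e N p m d = H.C k \<longleftrightarrow> d = H.D k"
      using H.D_unique H.diff_derivation_D H.deriv_lax_operator_D by metis
  qed (rule flow H.D_commute H.D_infinite_dimensional H.D_Res)+
qed

end
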